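(* Let $\mathcal{A}$ be a unital complex algebra, $\psi:\mathcal{A}\to\mathbb{C}$ a unital linear functional and $D\psi:\mathcal{A}\to\mathbb{C}$ a tracial linear functional with $D\psi(1_{\mathcal{A}})=0$. Unital subalgebras $(\mathcal{A}_i)_{i\in I}$ of $\mathcal{A}$ are cyclically free relatively to $(\psi,D\psi)$ if and only if all mixed free cumulants $(\kappa^\psi_n)_{n\ge1}$ and all mixed cyclic free cumulants $(D\kappa^\psi_n)_{n\ge1}$ vanish.
   Context: Cyclic freeness: unital subalgebras $(\mathcal{A}_i)$ are cyclically free relatively to $(\psi,\omega)$, $\omega$ tracial, if they are free with respect to $\psi$ and $\omega(a_1\cdots a_n)=0$ for all $n\ge2$ and $a_k\in\mathcal{A}_{j_k}$ with $\psi(a_k)=0$ for all $k$, $j_k\ne j_{k+1}$ for $1\le k\le n-1$, and $j_n\ne j_1$. Free cumulants $\kappa^\psi_n$: $\psi(a_1\cdots a_n)=\sum_{\pi\in NC(n)}\prod_{V\in\pi}\kappa^\psi_{|V|}(a_V)$, where $NC(n)$ is the set of non-crossing partitions of $[n]=\{1,\ldots,n\}$ and $a_V$ lists $(a_v)_{v\in V}$ in increasing order. Cyclic free cumulants $D\kappa^\psi_n:\mathcal{A}^{\otimes n}\to\mathbb{C}$ relatively to $(\psi,D\psi)$ are defined recursively by $$D\psi(a_1\cdots a_n)=\sum_{\pi\in NC(n)}[\kappa^\psi,D\kappa^\psi]_\pi(a_1,\ldots,a_n),$$ where for $f=(f_n)$ and a sequence $Df=(Df_n)$ of cyclically invariant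 functionals, $[f,Df]_\pi(a_1,\ldots,a_n)=\sum_{V\in\pi}Df_{|V|}(a_V)\prod_{W\in\pi,W\ne V}f_{|W|}(a_{(W,\prec_V)})$. Here $a_{(W,\prec_V)}$ lists $(a_w)_{w\in W}$ as follows: arrange $1,\ldots,n$ clockwise on a circle; $W$ lies in one arc between two cyclically consecutive elements of $V$ (the whole circle minus $V$ if $|V|=1$), and $W$ is listed in the order met when traversing this arc clockwise. A cumulant is mixed if its arguments $a_k\in\mathcal{A}_{j_k}$ come from at least two distinct algebras (the $j_k$ are not all equal). *)

theory Defs
  imports Complex_Main "HOL-Library.Disjoint_Sets"
begin

locale complex_algebra = vector_space scale
  for scale :: "complex \<Rightarrow> 'a::ring_1 \<Rightarrow> 'a" +
  assumes scale_mult_left: "scale c x * y = scale c (x * y)"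
    and scale_mult_right: "x * scale c y = scale c (x * y)"

definition unital_subalgebra :: "(complex \<Rightarrow> 'a::ring_1 \<Rightarrow> 'a) \<Rightarrow> 'a set \<Rightarrow> bool" where
  "unital_subalgebra scale S \<longleftrightarrow>
     module.subspace scale S \<and> 1 \<in> S \<and> (\<forall>x\<in>S. \<forall>y\<in>S. x * y \<in> S)"

definition tracial :: "('a::ring_1 \<Rightarrow> complex) \<Rightarrow> bool" where
  "tracial \<omega> \<longleftrightarrow> (\<forall>x y. \<omega> (x * y) = \<omega> (y * x))"

text \<open>A word \<open>a\<^sub>1, \<dots>, a\<^sub>n\<close> with \<open>a\<^sub>k\<close> in the \<open>j\<^sub>k\<close>-th subalgebra is a pair of lists \<open>js\<close>, \<open>as\<close>
  of equal length \<open>n\<close>.\<close>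

definition word_in :: "'i set \<Rightarrow> ('i \<Rightarrow> 'a set) \<Rightarrow> 'i list \<Rightarrow> 'a list \<Rightarrow> bool" where
  "word_in I A js as \<longleftrightarrow> list_all2 (\<lambda>j a. j \<in> I \<and> a \<in> A j) js as"

definition free_wrt :: "'i set \<Rightarrow> ('i \<Rightarrow> 'a::ring_1 set) \<Rightarrow> ('a \<Rightarrow> complex) \<Rightarrow> bool" where
  "free_wrt I A \<psi> \<longleftrightarrow>
     (\<forall>js as. word_in I A js as \<and> length as \<ge> 1 \<and> (\<forall>a\<in>set as. \<psi> a = 0) \<and> distinct_adj js
        \<longrightarrow> \<psi> (prod_list as) = 0)"

definition cyclically_free ::
  "'i set \<Rightarrow> ('i \<Rightarrow> 'a::ring_1 set) \<Rightarrow> ('a \<Rightarrow> complex) \<Rightarrow> ('a \<Rightarrow> complex) \<Rightarrow> bool" where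
  "cyclically_free I A \<psi> \<omega> \<longleftrightarrow>
     free_wrt I A \<psi> \<and>
     (\<forall>js as. word_in I A js as \<and> length as \<ge> 2 \<and> (\<forall>a\<in>set as. \<psi> a = 0)
          \<and> distinct_adj js \<and> last js \<noteq> hd js
        \<longrightarrow> \<omega> (prod_list as) = 0)"

text \<open>Positions are counted from 0, so the partitioned set is \<open>{..<n}\<close>.\<close>

definition noncrossing :: "nat set set \<Rightarrow> bool" where
  "noncrossing \<pi> \<longleftrightarrow>
     (\<forall>V\<in>\<pi>. \<forall>W\<in>\<pi>. \<forall>a b c d. a < b \<and> b < c \<and> c < d \<and> a \<in> V \<and> c \<in> V \<and> b \<in> W \<and> d \<in> W
        \<longrightarrow> V = W)"

definition NC :: "nat \<Rightarrow> nat set set set" where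
  "NC n = {\<pi>. partition_on {..<n} \<pi> \<and> noncrossing \<pi>}"

lemma finite_NC: "finite (NC n)"
  by (rule finite_subset[of _ "Pow (Pow {..<n})"])
     (auto simp: NC_def partition_on_def)

lemma top_in_NC: "n \<noteq> 0 \<Longrightarrow> {{..<n}} \<in> NC n"
  by (auto simp: NC_def noncrossing_def partition_on_def disjoint_def)

lemma length_nths_NC:
  assumes "\<pi> \<in> NC (length xs)" "\<pi> \<noteq> {{..<length xs}}" "V \<in> \<pi>"
  shows "length (nths xs V) < length xs"
proof -
  have p: "partition_on {..<length xs} \<pi>"
    using assms(1) by (simp add: NC_def)
  have sub: "V \<subseteq> {..<length xs}"
    using p assms(3) by (auto simp: partition_on_def)
  have "V \<noteq> {..<length xs}"
  proof
    assume V: "V = {..<length xs}"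
    have "W = V" if W: "W \<in> \<pi>" for W
    proof (rule ccontr)
      assume "W \<noteq> V"
      with p W assms(3) have "W \<inter> V = {}" "W \<noteq> {}" "W \<subseteq> {..<length xs}"
        by (auto simp: partition_on_def disjoint_def)
      with V show False by auto
    qed
    with assms(3) have "\<pi> = {V}" by blast
    with V assms(2) show False by simp
  qed
  with sub have "V \<subset> {..<length xs}" by auto
  then have "card V < length xs"
    using psubset_card_mono[of "{..<length xs}" V] by simp
  moreover have "{i. i < length xs \<and> i \<in> V} = V" using sub by auto
  ultimately show ?thesis by (simp add: length_nths)
qed

text \<open>\<open>free_cumulant \<psi> [a\<^sub>1, \<dots>, a\<^sub>n]\<close> is \<open>\<kappa>\<^sup>\<psi>\<^sub>n(a\<^sub>1, \<dots>, a\<^sub>n)\<close>: the moment-cumulant formula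
  solved for the term of the one-block partition; see \<open>moment_free_cumulant\<close> below.
  The list \<open>nths as V\<close> is \<open>a\<^sub>V\<close>.\<close>

function free_cumulant :: "('a::ring_1 \<Rightarrow> complex) \<Rightarrow> 'a list \<Rightarrow> complex" where
  "free_cumulant \<psi> as =
     \<psi> (prod_list as) -
     (\<Sum>\<pi> \<in> {\<pi> \<in> NC (length as). \<pi> \<noteq> {{..<length as}}}. \<Prod>V\<in>\<pi>. free_cumulant \<psi> (nths as V))"
  by auto
termination
  by (relation "measure (\<lambda>(\<psi>, as). length as)") (auto intro: length_nths_NC)

declare free_cumulant.simps [simp del]

text \<open>The positions met when going clockwise on the circle \<open>0, \<dots>, n - 1\<close> from \<open>v \<in> V\<close>
  (excluded) to the next element of \<open>V\<close> (excluded); all positions except \<open>v\<close> if \<open>V = {v}\<close>.\<close>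

definition arc :: "nat \<Rightarrow> nat set \<Rightarrow> nat \<Rightarrow> nat list" where
  "arc n V v = takeWhile (\<lambda>k. k \<notin> V) ([Suc v..<n] @ [0..<v])"

text \<open>The elements of \<open>W\<close> in the order \<open>\<prec>\<^sub>V\<close>. The arc is unique when \<open>V\<close> and \<open>W\<close> are distinct
  blocks of a non-crossing partition, the only case in which this is used.\<close>

definition arc_order :: "nat \<Rightarrow> nat set \<Rightarrow> nat set \<Rightarrow> nat list" where
  "arc_order n V W =
     filter (\<lambda>k. k \<in> W) (arc n V (THE v. v \<in> V \<and> W \<subseteq> set (arc n V v)))"

definition bracket ::
  "('a list \<Rightarrow> complex) \<Rightarrow> ('a list \<Rightarrow> complex) \<Rightarrow> nat set set \<Rightarrow> 'a list \<Rightarrow> complex" where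
  "bracket f Df \<pi> as =
     (\<Sum>V\<in>\<pi>. Df (nths as V) * (\<Prod>W\<in>\<pi> - {V}. f (map ((!) as) (arc_order (length as) V W))))"

lemma bracket_cong [fundef_cong]:
  assumes "f = f'" "\<pi> = \<pi>'" "as = as'" "\<And>V. V \<in> \<pi>' \<Longrightarrow> Df (nths as' V) = Df' (nths as' V)"
  shows "bracket f Df \<pi> as = bracket f' Df' \<pi>' as'"
  using assms by (simp add: bracket_def cong: sum.cong)

text \<open>\<open>cyclic_free_cumulant \<psi> \<omega> [a\<^sub>1, \<dots>, a\<^sub>n]\<close> is \<open>D\<kappa>\<^sup>\<psi>\<^sub>n(a\<^sub>1, \<dots>, a\<^sub>n)\<close> relatively to
  \<open>(\<psi>, \<omega>)\<close>; see \<open>moment_cyclic_free_cumulant\<close> below.\<close>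

function cyclic_free_cumulant ::
  "('a::ring_1 \<Rightarrow> complex) \<Rightarrow> ('a \<Rightarrow> complex) \<Rightarrow> 'a list \<Rightarrow> complex" where
  "cyclic_free_cumulant \<psi> \<omega> as =
     \<omega> (prod_list as) -
     (\<Sum>\<pi> \<in> {\<pi> \<in> NC (length as). \<pi> \<noteq> {{..<length as}}}.
        bracket (free_cumulant \<psi>) (cyclic_free_cumulant \<psi> \<omega>) \<pi> as)"
  by auto
termination
  by (relation "measure (\<lambda>(\<psi>, \<omega>, as). length as)") (auto intro: length_nths_NC)

declare cyclic_free_cumulant.simps [simp del]

lemma sum_NC_split:
  fixes g :: "nat set set \<Rightarrow> complex"
  assumes "n \<noteq> 0"
  shows "(\<Sum>\<pi>\<in>NC n. g \<pi>) = g {{..<n}} + (\<Sum>\<pi> \<in> {\<pi> \<in> NC n. \<pi> \<noteq> {{..<n}}}. g \<pi>)"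
proof -
  have "{\<pi> \<in> NC n. \<pi> \<noteq> {{..<n}}} = NC n - {{{..<n}}}" by auto
  then show ?thesis
    by (simp add: sum.remove[OF finite_NC top_in_NC[OF assms]])
qed

lemma nths_full: "nths as {..<length as} = as"
  by (rule nths_all) simp

lemma moment_free_cumulant:
  assumes "as \<noteq> []"
  shows "\<psi> (prod_list as) = (\<Sum>\<pi>\<in>NC (length as). \<Prod>V\<in>\<pi>. free_cumulant \<psi> (nths as V))"
proof -
  have n: "length as \<noteq> 0" using assms by simp
  have "(\<Prod>V\<in>{{..<length as}}. free_cumulant \<psi> (nths as V)) = free_cumulant \<psi> as"
    by (simp add: nths_full)
  then show ?thesis
    using free_cumulant.simps[of \<psi> as]
    unfolding sum_NC_split[OF n] by (simp only: diff_add_cancel)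
qed

lemma moment_cyclic_free_cumulant:
  assumes "as \<noteq> []"
  shows "\<omega> (prod_list as) =
    (\<Sum>\<pi>\<in>NC (length as). bracket (free_cumulant \<psi>) (cyclic_free_cumulant \<psi> \<omega>) \<pi> as)"
proof -
  have n: "length as \<noteq> 0" using assms by simp
  have "bracket (free_cumulant \<psi>) (cyclic_free_cumulant \<psi> \<omega>) {{..<length as}} as =
      cyclic_free_cumulant \<psi> \<omega> as"
    by (simp add: bracket_def nths_full)
  then show ?thesis
    using cyclic_free_cumulant.simps[of \<psi> \<omega> as]
    unfolding sum_NC_split[OF n] by (simp only: diff_add_cancel)
qed

definition mixed_cumulants_vanish ::
  "'i set \<Rightarrow> ('i \<Rightarrow> 'a set) \<Rightarrow> ('a list \<Rightarrow> complex) \<Rightarrow> bool" where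
  "mixed_cumulants_vanish I A \<kappa> \<longleftrightarrow>
     (\<forall>js as. word_in I A js as \<and> (\<exists>j\<in>set js. \<exists>j'\<in>set js. j \<noteq> j') \<longrightarrow> \<kappa> as = 0)"

end

theory Submission
  imports Defs "HOL-Library.FuncSet"
begin

text \<open>
  Write \<open>M w\<close> and \<open>N w\<close> for the values of the two functionals on the product of a word \<open>w\<close>.
  Fixing one block \<open>V\<close> of a non-crossing partition, the other blocks form independent
  non-crossing partitions of the arcs cut out by \<open>V\<close>. Hence \<open>M w\<close> is the sum, over the blocks \<open>V\<close>
  containing the first letter, of the cumulant of \<open>V\<close> times the product of \<open>M\<close> over the arcs, and
  \<open>N w\<close> is the same sum over all nonempty \<open>V\<close> with cyclic cumulants and cyclic arcs.

  On a (cyclically) alternating word of centered letters in free algebras every nonempty arc has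
  moment 0, so only the full block survives and the moment equals the cumulant. This settles such
  words in both directions. The cumulants are multilinear and vanish when one entry is 1
  (apart from the first free cumulant), so entries may be centered. If two (cyclically) adjacent
  letters \<open>a\<close>, \<open>b\<close> lie in the same algebra, the formula for the cumulant with the entry \<open>a * b\<close>
  expresses the cumulant of the given word by shorter ones, one of which is mixed in every summand.
  All formulas for cumulants follow by comparing the recursions for \<open>M\<close> and \<open>N\<close>, which
  determine the cumulants.
\<close>

section \<open>Sums over subwords weighted by their gaps\<close>

text \<open>\<open>gap_sum M F [] w\<close> sums over all subwords \<open>v\<close> of \<open>w\<close> the product of the values of \<open>M\<close> on the
  gaps, i.e. the maximal runs of unchosen letters, with the exception of the last gap \<open>h\<close>,
  which enters through the factor \<open>F v h\<close>. The argument \<open>g\<close> holds the part of the current gap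
  that has already been read.\<close>

primrec gap_sum ::
  "('a list \<Rightarrow> complex) \<Rightarrow> ('a list \<Rightarrow> 'a list \<Rightarrow> complex) \<Rightarrow> 'a list \<Rightarrow> 'a list \<Rightarrow> complex" where
  "gap_sum M F g [] = F [] g"
| "gap_sum M F g (y # w) = gap_sum M F (g @ [y]) w + M g * gap_sum M (\<lambda>v. F (y # v)) [] w"

text \<open>Here the first gap, not the last, carries a free weight \<open>P\<close>; all later
  gaps, the last one included, carry \<open>M\<close>. If no letter is chosen, the whole word is the
  first gap.\<close>

primrec first_gap_sum ::
  "('a list \<Rightarrow> complex) \<Rightarrow> ('a list \<Rightarrow> complex) \<Rightarrow> ('a list \<Rightarrow> complex) \<Rightarrow> 'a list \<Rightarrow> complex" where
  "first_gap_sum M \<phi> P [] = P [] * \<phi> []"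
| "first_gap_sum M \<phi> P (y # w) = first_gap_sum M \<phi> (\<lambda>h. P (y # h)) w
     + P [] * gap_sum M (\<lambda>v h. \<phi> (y # v) * M h) [] w"

text \<open>The gap still open at the end of \<open>u\<close> is continued by the letters of
  \<open>z\<close>, so it becomes the accumulator of the inner sum.\<close>

lemma gap_sum_append:
  "gap_sum M F g (u @ z) = gap_sum M (\<lambda>v h. gap_sum M (\<lambda>v'. F (v @ v')) h z) g u"
  by (induction u arbitrary: F g) auto

lemma gap_sum_add:
  "gap_sum M (\<lambda>v h. F v h + F' v h) g w = gap_sum M F g w + gap_sum M F' g w"
  by (induction w arbitrary: F F' g) (auto simp: algebra_simps)

lemma gap_sum_diff:
  "gap_sum M (\<lambda>v h. F v h - F' v h) g w = gap_sum M F g w - gap_sum M F' g w"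
  using gap_sum_add[of M F' "\<lambda>v h. F v h - F' v h" g w] by simp

lemma gap_sum_mult_left:
  "gap_sum M (\<lambda>v h. c * F v h) g w = c * gap_sum M F g w"
  by (induction w arbitrary: F g) (auto simp: algebra_simps)

lemma gap_sum_mult_right:
  "gap_sum M (\<lambda>v h. F v h * c) g w = gap_sum M F g w * c"
  by (induction w arbitrary: F g) (auto simp: algebra_simps)

lemma gap_sum_cong:
  assumes "\<And>v h. length h \<le> length g + length w \<Longrightarrow> F v h = F' v h"
  shows "gap_sum M F g w = gap_sum M F' g w"
  using assms
proof (induction w arbitrary: F F' g)
  case (Cons y w)
  have "gap_sum M F (g @ [y]) w = gap_sum M F' (g @ [y]) w"
    using Cons.prems by (intro Cons.IH) auto
  moreover have "gap_sum M (\<lambda>v. F (y # v)) [] w = gap_sum M (\<lambda>v. F' (y # v)) [] w"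
    using Cons.prems by (intro Cons.IH) auto
  ultimately show ?case by simp
qed simp

lemma gap_sum_zero:
  assumes "\<And>v h. length v \<le> length w \<Longrightarrow> F v h = 0"
  shows "gap_sum M F g w = 0"
  using assms by (induction w arbitrary: F g) auto

lemma gap_sum_top:
  assumes "M [] = 1" "\<And>v h. length v < length w \<Longrightarrow> F v h = 0"
  shows "gap_sum M F [] w = F w []"
  using assms
proof (induction w arbitrary: F)
  case (Cons y w)
  have "gap_sum M F [y] w = 0"
    using Cons.prems(2) by (intro gap_sum_zero) auto
  moreover have "gap_sum M (\<lambda>v. F (y # v)) [] w = F (y # w) []"
    using Cons.prems by (intro Cons.IH) auto
  ultimately show ?case
    using Cons.prems(1) by simp
qed simp

text \<open>Triangularity: the sum is \<open>f w\<close> plus terms with \<open>f\<close> on shorter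
  words, so such sums determine \<open>f\<close>. This turns comparisons of moment recursions into
  identities between cumulants.\<close>

lemma gap_sum_eq_zero_imp:
  assumes "M [] = 1" "\<And>w. gap_sum M (\<lambda>v h. f v * M h) [] w = 0"
  shows "f w = 0"
proof (induction w rule: length_induct)
  case (1 w)
  then have "gap_sum M (\<lambda>v h. f v * M h) [] w = f w * M []"
    using assms(1) by (intro gap_sum_top) auto
  then show ?case using assms by simp
qed

lemma gap_sum_eq_imp:
  assumes "M [] = 1"
    and "\<And>w. gap_sum M (\<lambda>v h. f v * M h) [] w = gap_sum M (\<lambda>v h. f' v * M h) [] w"
  shows "f w = f' w"
proof -
  have "f w - f' w = 0"
    by (rule gap_sum_eq_zero_imp[of M "\<lambda>v. f v - f' v"])
       (simp_all add: assms left_diff_distrib gap_sum_diff)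
  then show ?thesis by simp
qed

text \<open>The gap starting with \<open>g\<close> is either closed by a chosen letter after some
  prefix \<open>p\<close>, giving the factor \<open>M (g @ p)\<close>, or never closed, giving
  \<open>F [] (g @ w)\<close>.\<close>

lemma gap_sum_open_gap_zero:
  assumes "\<And>p q. w = p @ q \<Longrightarrow> M (g @ p) = 0" "F [] (g @ w) = 0"
  shows "gap_sum M F g w = 0"
  using assms
proof (induction w arbitrary: g)
  case (Cons y w)
  have "gap_sum M F (g @ [y]) w = 0"
  proof (rule Cons.IH)
    show "M ((g @ [y]) @ p) = 0" if "w = p @ q" for p q
      using Cons.prems(1)[of "y # p" q] that by simp
  qed (use Cons.prems(2) in simp)
  moreover have "M g = 0" using Cons.prems(1)[of "[]"] by simp
  ultimately show ?case by simp
qed simp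

text \<open>A proper subword either leaves a nonempty gap before one of its letters, where
  \<open>M\<close> vanishes, or is a proper prefix \<open>p\<close> with last gap \<open>q\<close>,
  where \<open>F\<close> vanishes.\<close>

lemma gap_sum_full:
  assumes "M [] = 1"
    and "\<And>p q r. w = p @ q @ r \<Longrightarrow> q \<noteq> [] \<Longrightarrow> M q = 0"
    and "\<And>p q. w = p @ q \<Longrightarrow> q \<noteq> [] \<Longrightarrow> F p q = 0"
  shows "gap_sum M F [] w = F w []"
  using assms
proof (induction w arbitrary: F)
  case (Cons y w)
  have "gap_sum M F [y] w = 0"
  proof (rule gap_sum_open_gap_zero)
    show "M ([y] @ p) = 0" if "w = p @ q" for p q
      using Cons.prems(2)[of "[]" "[y] @ p" q] that by simp
    show "F [] ([y] @ w) = 0" using Cons.prems(3)[of "[]"] by simp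
  qed
  moreover have "gap_sum M (\<lambda>v. F (y # v)) [] w = F (y # w) []"
  proof (rule Cons.IH)
    show "M q = 0" if "w = p @ q @ r" "q \<noteq> []" for p q r
      using Cons.prems(2)[of "y # p" q r] that by simp
    show "F (y # p) q = 0" if "w = p @ q" "q \<noteq> []" for p q
      using Cons.prems(3)[of "y # p" q] that by simp
  qed (rule Cons.prems(1))
  ultimately show ?case
    using Cons.prems(1) by simp
qed simp

section \<open>Expansion of the first or the last gap\<close>

lemma first_gap_sum_add:
  "first_gap_sum M \<phi> (\<lambda>h. P h + c * Q h) w = first_gap_sum M \<phi> P w + c * first_gap_sum M \<phi> Q w"
  by (induction w arbitrary: P Q) (auto simp: algebra_simps)

text \<open>The accumulator \<open>g\<close> affects only the first gap. In this form the weight of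
  that gap can be rewritten separately.\<close>

lemma gap_sum_eq_first_gap_sum:
  "gap_sum M (\<lambda>v h. \<phi> v * M h) g w = first_gap_sum M \<phi> (\<lambda>h. M (g @ h)) w"
  by (induction w arbitrary: g) auto

lemma gap_sum_gap_cong:
  assumes "\<And>h. M (g @ h) = M (g' @ h)"
  shows "gap_sum M (\<lambda>v h. \<phi> v * M h) g w = gap_sum M (\<lambda>v h. \<phi> v * M h) g' w"
  unfolding gap_sum_eq_first_gap_sum assms ..

text \<open>Choosing one subword inside the first gap and another one after it amounts to choosing
  their concatenation \<open>v\<close> together with the point \<open>i\<close> where it is
  cut.\<close>

lemma first_gap_sum_gap_sum:
  "first_gap_sum M \<phi> (gap_sum M (\<lambda>v h. \<chi> v * M h) g) w =
    gap_sum M (\<lambda>v h. (\<Sum>i\<le>length v. \<chi> (take i v) * \<phi> (drop i v)) * M h) g w"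
proof (induction w arbitrary: \<chi> g)
  case (Cons y w)
  have "first_gap_sum M \<phi> (gap_sum M (\<lambda>v h. \<chi> v * M h) g) (y # w) =
      first_gap_sum M \<phi> (\<lambda>h. gap_sum M (\<lambda>v h. \<chi> v * M h) (g @ [y]) h
        + M g * gap_sum M (\<lambda>v h. \<chi> (y # v) * M h) [] h) w
      + \<chi> [] * M g * gap_sum M (\<lambda>v h. \<phi> (y # v) * M h) [] w"
    by simp
  also have "\<dots> = gap_sum M (\<lambda>v h. (\<Sum>i\<le>length v. \<chi> (take i v) * \<phi> (drop i v)) * M h) (g @ [y]) w
      + M g * gap_sum M (\<lambda>v h. (\<Sum>i\<le>length v. \<chi> (y # take i v) * \<phi> (drop i v)) * M h) [] w
      + \<chi> [] * M g * gap_sum M (\<lambda>v h. \<phi> (y # v) * M h) [] w"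
    unfolding first_gap_sum_add Cons.IH[of \<chi> "g @ [y]"] Cons.IH[of "\<lambda>v. \<chi> (y # v)" "[]"] ..
  also have "\<dots> = gap_sum M (\<lambda>v h. (\<Sum>i\<le>length v. \<chi> (take i v) * \<phi> (drop i v)) * M h) g (y # w)"
    by (simp add: sum.atMost_Suc_shift distrib_right gap_sum_add mult.assoc gap_sum_mult_left
        distrib_left mult.left_commute[of "M g"] add_ac del: sum.atMost_Suc)
  finally show ?case .
qed simp

text \<open>Applied with \<open>g = [x]\<close> and the moment recursion as assumption: a gap opened
  by the unchosen letter \<open>x\<close> is expanded along the block of \<open>x\<close>.\<close>

lemma gap_sum_expand_first:
  assumes "\<And>h. M (g @ h) = gap_sum M (\<lambda>v h. \<chi> v * M h) [] h"
  shows "gap_sum M (\<lambda>v h. \<phi> v * M h) g w =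
    gap_sum M (\<lambda>v h. (\<Sum>i\<le>length v. \<chi> (take i v) * \<phi> (drop i v)) * M h) [] w"
  unfolding gap_sum_eq_first_gap_sum[of M \<phi>] assms first_gap_sum_gap_sum[symmetric] ..

text \<open>The counterpart for the last gap. The induction runs from the right: a new letter
  \<open>x\<close> extends the inner last gap or is chosen in the inner sum, which
  \<open>\<Psi>'\<close> records.\<close>

lemma gap_sum_expand_last:
  "gap_sum M (\<lambda>v h. \<phi> v * gap_sum M \<Psi> [] h) [] w =
    gap_sum M (\<lambda>v h. \<Sum>i\<le>length v. \<phi> (take i v) * \<Psi> (drop i v) h) [] w"
proof (induction w arbitrary: \<Psi> rule: rev_induct)
  case (snoc x w)
  define \<Psi>' where "\<Psi>' = (\<lambda>v h. \<Psi> v (h @ [x]) + M h * \<Psi> (v @ [x]) [])"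
  have "gap_sum M (\<lambda>v h. \<phi> v * gap_sum M \<Psi> [] h) [] (w @ [x]) =
      gap_sum M (\<lambda>v h. \<phi> v * gap_sum M \<Psi>' [] h + M h * (\<phi> (v @ [x]) * \<Psi> [] [])) [] w"
    by (simp add: gap_sum_append \<Psi>'_def)
  also have "\<dots> = gap_sum M (\<lambda>v h. (\<Sum>i\<le>length v. \<phi> (take i v) * \<Psi>' (drop i v) h)
      + M h * (\<phi> (v @ [x]) * \<Psi> [] [])) [] w"
    by (simp add: gap_sum_add snoc.IH)
  also have "\<dots> = gap_sum M (\<lambda>v h. \<Sum>i\<le>length v. \<phi> (take i v) * \<Psi> (drop i v) h) [] (w @ [x])"
    by (simp add: gap_sum_append \<Psi>'_def sum.distrib algebra_simps sum_distrib_left)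
  finally show ?case .
qed simp

lemma gap_sum_weight_right:
  "gap_sum M (\<lambda>v h. M h * X v) g w = gap_sum M (\<lambda>v h. X v * M h) g w"
  by (simp add: mult.commute)

section \<open>Cumulants determined by the moment recursions\<close>

locale moment_cumulant =
  fixes M \<kappa> :: "'a list \<Rightarrow> complex"
  assumes M_Nil: "M [] = 1"
    and M_Cons: "M (x # w) = gap_sum M (\<lambda>v h. \<kappa> (x # v) * M h) [] w"
begin

lemma M_Cons': "M ([x] @ w) = gap_sum M (\<lambda>v h. \<kappa> (x # v) * M h) [] w"
  using M_Cons by simp

text \<open>The given recursion singles out the first letter, so the one for the last letter
  \<open>x\<close> needs an argument: the block of the first letter \<open>c\<close> either contains
  \<open>x\<close> or leaves it in its last gap, to which the induction hypothesis applies.\<close>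

lemma M_snoc: "M (w @ [x]) = gap_sum M (\<lambda>v h. \<kappa> (v @ [x]) * M h) [] w"
proof (induction w rule: length_induct)
  case (1 w)
  show ?case
  proof (cases w)
    case Nil
    then show ?thesis by (simp add: M_Cons M_Nil)
  next
    case (Cons c u)
    have "M (w @ [x]) = gap_sum M (\<lambda>v h. \<kappa> (c # v) * M (h @ [x])) [] u
        + gap_sum M (\<lambda>v h. \<kappa> (c # v @ [x]) * M h) [] u"
      by (simp add: Cons M_Cons gap_sum_append M_Nil gap_sum_add mult.commute)
    also have "gap_sum M (\<lambda>v h. \<kappa> (c # v) * M (h @ [x])) [] u =
        gap_sum M (\<lambda>v h. \<kappa> (c # v) * gap_sum M (\<lambda>v h. \<kappa> (v @ [x]) * M h) [] h) [] u"
      using 1 by (intro gap_sum_cong) (simp add: Cons)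
    also have "\<dots> = gap_sum M (\<lambda>v h. (\<Sum>i\<le>length v. \<kappa> (c # take i v) * \<kappa> (drop i v @ [x])) * M h) [] u"
      by (simp add: gap_sum_expand_last sum_distrib_right mult.assoc)
    \<comment> \<open>The accumulator \<open>[c]\<close> keeps \<open>c\<close> out of the block of
      \<open>x\<close>. Expanding the gap that \<open>c\<close> opens yields the same pairs of
      blocks.\<close>
    also have "\<dots> = gap_sum M (\<lambda>v h. \<kappa> (v @ [x]) * M h) [c] u"
      by (simp add: gap_sum_expand_first[OF M_Cons'])
    finally show ?thesis by (simp add: Cons M_Nil)
  qed
qed

lemma M_append_cong_gap_sum:
  assumes "\<And>u w. M (u @ p @ w) = M (u @ q @ w)"
  shows "gap_sum M (\<lambda>v h. \<phi> v * M h) (g @ p) w = gap_sum M (\<lambda>v h. \<phi> v * M h) (g @ q) w"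
  using assms by (intro gap_sum_gap_cong) simp

text \<open>The three terms: neither letter chosen, only \<open>b\<close> chosen, \<open>a\<close>
  chosen. In the last one the gap opened by an unchosen \<open>b\<close> is expanded along the block
  of \<open>b\<close>.\<close>

lemma expand_pair:
  "gap_sum M (\<lambda>v h. \<phi> v * M h) h (a # b # w) =
    gap_sum M (\<lambda>v h. \<phi> v * M h) (h @ [a, b]) w +
    M (h @ [a]) * gap_sum M (\<lambda>v h. \<phi> (b # v) * M h) [] w +
    M h * gap_sum M (\<lambda>v h. ((\<Sum>i\<le>length v. \<kappa> (b # take i v) * \<phi> (a # drop i v))
       + \<phi> (a # b # v)) * M h) [] w"
  by (simp add: gap_sum_expand_first[OF M_Cons', of "\<lambda>v. \<phi> (a # v)"] M_Nil distrib_right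
      gap_sum_add distrib_left)

text \<open>Both moments are expanded along the block of the first letter. In
  \<open>a # b # w\<close> this block contains \<open>b\<close>, or \<open>b\<close> opens a gap,
  which is expanded in turn.\<close>

lemma cumulant_merge_first:
  assumes "\<And>u w. M (u @ [c] @ w) = M (u @ [a, b] @ w)"
  shows "\<kappa> (c # w) = \<kappa> (a # b # w) + (\<Sum>i\<le>length w. \<kappa> (b # take i w) * \<kappa> (a # drop i w))"
proof -
  have "gap_sum M (\<lambda>v h. \<kappa> (c # v) * M h) [] w = gap_sum M (\<lambda>v h. (\<kappa> (a # b # v) +
      (\<Sum>i\<le>length v. \<kappa> (b # take i v) * \<kappa> (a # drop i v))) * M h) [] w" for w
  proof -
    have "M (c # w) = M (a # b # w)"
      using assms[of "[]" w] by simp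
    then show ?thesis
      by (simp add: M_Cons[of a] M_Cons[of c] M_Nil distrib_right gap_sum_add
          gap_sum_expand_first[OF M_Cons', of "\<lambda>v. \<kappa> (a # v)"])
  qed
  from gap_sum_eq_imp[OF M_Nil this] show ?thesis .
qed

text \<open>With letters in front of the merged pair, \<open>a\<close> may also close a gap before a
  chosen \<open>b\<close>. Uniqueness is applied twice, first for the letters before the pair and
  then for those after it.\<close>

lemma cumulant_merge_inner:
  assumes "\<And>u w. M (u @ [c] @ w) = M (u @ [a, b] @ w)"
  shows "\<kappa> (x # u @ c # w) = \<kappa> (x # u @ a # b # w)
    + (\<Sum>i\<le>length w. \<kappa> (b # take i w) * \<kappa> (x # u @ a # drop i w))
    + (\<Sum>i\<le>length u. \<kappa> (x # take i u @ b # w) * \<kappa> (drop i u @ [a]))"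
proof -
  \<comment> \<open>\<open>f\<close> collects the terms whose block of \<open>x\<close> contains
    \<open>c\<close>, \<open>f1\<close> those where it contains \<open>a\<close>, and
    \<open>f2\<close> those where it contains \<open>b\<close> but not \<open>a\<close>.\<close>
  define f where "f v v' = \<kappa> (x # v @ c # v')" for v v'
  define f1 where "f1 v v' = \<kappa> (x # v @ a # b # v')
    + (\<Sum>i\<le>length v'. \<kappa> (b # take i v') * \<kappa> (x # v @ a # drop i v'))" for v v'
  define f2 where "f2 v v' = \<kappa> (x # v @ b # v')" for v v'
  have 1: "gap_sum M (\<lambda>v h. gap_sum M (\<lambda>v' h. f v v' * M h) [] w * M h) [] u =
      gap_sum M (\<lambda>v h. gap_sum M (\<lambda>v' h. (f1 v v' +
        (\<Sum>i\<le>length v. f2 (take i v) v' * \<kappa> (drop i v @ [a]))) * M h) [] w * M h) [] u" for u w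
  proof -
    \<comment> \<open>\<open>?G\<close> sums over the blocks of \<open>x\<close> that avoid the
      merged letters. There these letters occur only inside a value of \<open>M\<close>, which does
      not distinguish \<open>c\<close> from \<open>a\<close>, \<open>b\<close>.\<close>
    let ?G = "\<lambda>g z u. gap_sum M (\<lambda>v h. gap_sum M (\<lambda>v' h. \<kappa> (x # v @ v') * M h) (g h) z) [] u"
    have "M ((x # u) @ [c] @ w) = ?G (\<lambda>h. h @ [c]) w u
        + gap_sum M (\<lambda>v h. gap_sum M (\<lambda>v' h. f v v' * M h) [] w * M h) [] u"
      by (simp add: M_Cons gap_sum_append gap_sum_add f_def gap_sum_weight_right)
    moreover have "M ((x # u) @ [a, b] @ w) = ?G (\<lambda>h. h @ [a, b]) w u
        + gap_sum M (\<lambda>v h. gap_sum M (\<lambda>v' h. f2 v v' * M h) [] w * M (h @ [a])) [] u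
        + gap_sum M (\<lambda>v h. gap_sum M (\<lambda>v' h. f1 v v' * M h) [] w * M h) [] u"
      by (simp add: M_Cons gap_sum_append expand_pair gap_sum_add f1_def f2_def gap_sum_weight_right
          mult.commute[of "M (_ @ [a])"] add.commute[of "\<kappa> _"] del: gap_sum.simps(2))
    moreover have "?G (\<lambda>h. h @ [c]) w u = ?G (\<lambda>h. h @ [a, b]) w u"
      by (simp only: M_append_cong_gap_sum[OF assms])
    \<comment> \<open>The gap before \<open>b\<close> ends with \<open>a\<close> and is expanded
      along the block of this last letter.\<close>
    moreover have "gap_sum M (\<lambda>v h. gap_sum M (\<lambda>v' h. f2 v v' * M h) [] w * M (h @ [a])) [] u =
        gap_sum M (\<lambda>v h. (\<Sum>i\<le>length v. gap_sum M (\<lambda>v' h. f2 (take i v) v' * M h) [] w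
          * \<kappa> (drop i v @ [a])) * M h) [] u"
      by (simp only: M_snoc gap_sum_expand_last sum_distrib_right mult.assoc)
    moreover have "(\<Sum>i\<le>n. gap_sum M (\<lambda>v' h. f2 (take i v) v' * M h) [] w * \<kappa> (drop i v @ [a])) =
       gap_sum M (\<lambda>v' h. (\<Sum>i\<le>n. f2 (take i v) v' * \<kappa> (drop i v @ [a])) * M h) [] w" for v n
    proof (induction n)
      case (Suc n)
      show ?case
        by (simp add: Suc.IH distrib_right gap_sum_add)
           (simp add: mult_ac flip: gap_sum_mult_left gap_sum_mult_right)
    qed (simp add: mult_ac flip: gap_sum_mult_left gap_sum_mult_right)
    ultimately show ?thesis
      using assms[of "x # u" w] by (simp add: distrib_right gap_sum_add add.commute)
  qed
  have "gap_sum M (\<lambda>v' h. f u v' * M h) [] w =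
      gap_sum M (\<lambda>v' h. (f1 u v' + (\<Sum>i\<le>length u. f2 (take i u) v' * \<kappa> (drop i u @ [a]))) * M h) [] w"
    for w
    by (rule gap_sum_eq_imp[where f = "\<lambda>v. gap_sum M (\<lambda>v' h. f v v' * M h) [] w"
        and f' = "\<lambda>v. gap_sum M (\<lambda>v' h. (f1 v v' +
          (\<Sum>i\<le>length v. f2 (take i v) v' * \<kappa> (drop i v @ [a]))) * M h) [] w", OF M_Nil 1])
  then have "f u w = f1 u w + (\<Sum>i\<le>length u. f2 (take i u) w * \<kappa> (drop i u @ [a]))"
    by (rule gap_sum_eq_imp[where M = M and f = "f u"
        and f' = "\<lambda>w. f1 u w + (\<Sum>i\<le>length u. f2 (take i u) w * \<kappa> (drop i u @ [a]))", OF M_Nil])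
  then show ?thesis by (simp add: f_def f1_def f2_def)
qed

text \<open>The product formula for free cumulants: the products run over the non-crossing
  partitions of \<open>u @ a # b # w\<close> into two blocks that separate \<open>a\<close> from
  \<open>b\<close>. The second sum starts at \<open>Suc i\<close> because the cut in front of the
  whole word is already the term \<open>i = length w\<close> of the first sum.\<close>

lemma cumulant_merge:
  assumes "\<And>u w. M (u @ [c] @ w) = M (u @ [a, b] @ w)"
  shows "\<kappa> (u @ c # w) = \<kappa> (u @ a # b # w)
    + (\<Sum>i\<le>length w. \<kappa> (b # take i w) * \<kappa> (u @ a # drop i w))
    + (\<Sum>i<length u. \<kappa> (take (Suc i) u @ b # w) * \<kappa> (drop (Suc i) u @ [a]))"
proof (cases u)
  case Nil
  then show ?thesis using cumulant_merge_first[OF assms] by simp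
next
  case (Cons x u')
  then show ?thesis
    using cumulant_merge_inner[OF assms, of x u' w] by (simp add: lessThan_Suc_atMost)
qed

lemma cumulant_linear:
  assumes "\<And>u w. M (u @ c # w) = M (u @ a # w) + l * M (u @ b # w)"
  shows "\<kappa> (u @ c # w) = \<kappa> (u @ a # w) + l * \<kappa> (u @ b # w)"
proof (cases u)
  case Nil
  have "gap_sum M (\<lambda>v h. \<kappa> (c # v) * M h) [] w =
      gap_sum M (\<lambda>v h. (\<kappa> (a # v) + l * \<kappa> (b # v)) * M h) [] w" for w
    using assms[of "[]" w]
    by (simp add: M_Cons distrib_right gap_sum_add mult.assoc gap_sum_mult_left)
  from gap_sum_eq_imp[OF M_Nil this] show ?thesis using Nil by simp
next
  case (Cons x u')
  define S where "S y v w = gap_sum M (\<lambda>v' h. \<kappa> (x # v @ y # v') * M h) [] w" for y v w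
  have 1: "gap_sum M (\<lambda>v h. S c v w * M h) [] u =
      gap_sum M (\<lambda>v h. (S a v w + l * S b v w) * M h) [] u" for u w
  proof -
    \<comment> \<open>The part of the moment in which \<open>y\<close> is outside the block of
      \<open>x\<close>; its linearity is inherited from \<open>M\<close>, so the remaining parts can
      be compared.\<close>
    define G where "G y = gap_sum M (\<lambda>v h. gap_sum M (\<lambda>v' h. \<kappa> (x # v @ v') * M h) (h @ [y]) w) [] u"
      for y
    have *: "M (x # u @ y # w) = G y + gap_sum M (\<lambda>v h. S y v w * M h) [] u" for y
      by (simp add: M_Cons gap_sum_append gap_sum_add G_def S_def gap_sum_weight_right)
    have "gap_sum M (\<lambda>v h. \<phi> v * M h) (h @ [c]) w = gap_sum M (\<lambda>v h. \<phi> v * M h) (h @ [a]) w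
       + l * gap_sum M (\<lambda>v h. \<phi> v * M h) (h @ [b]) w" for \<phi> h
      by (simp add: gap_sum_eq_first_gap_sum assms first_gap_sum_add)
    then have "G c = G a + l * G b"
      by (simp add: G_def gap_sum_add gap_sum_mult_left)
    then show ?thesis
      using assms[of "x # u" w]
      by (simp add: * distrib_right distrib_left gap_sum_add mult.assoc gap_sum_mult_left)
  qed
  have "gap_sum M (\<lambda>v' h. \<kappa> (x # u' @ c # v') * M h) [] w =
      gap_sum M (\<lambda>v' h. (\<kappa> (x # u' @ a # v') + l * \<kappa> (x # u' @ b # v')) * M h) [] w" for w
    using gap_sum_eq_imp[OF M_Nil 1, of u' w]
    by (simp add: S_def distrib_right gap_sum_add mult.assoc gap_sum_mult_left)
  from gap_sum_eq_imp[OF M_Nil this] show ?thesis using Cons by simp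
qed

lemma cumulant_single: "\<kappa> [x] = M [x]"
  using M_Cons[of x "[]"] M_Nil by simp

end

text \<open>The prefix \<open>p\<close> holds the letters before the first chosen one. On the circle they follow the
  last gap, whence \<open>h @ p\<close>.\<close>

primrec avoiding_sum where
  "avoiding_sum M D p [] = (0::complex)"
| "avoiding_sum M D p (x # w) = avoiding_sum M D (p @ [x]) w
     + gap_sum M (\<lambda>v h. D (x # v) * M (h @ p)) [] w"

section \<open>Rotation, linearity and products for cyclic cumulants\<close>

locale cyclic_moment_cumulant = moment_cumulant M \<kappa> for M \<kappa> :: "'a list \<Rightarrow> complex" +
  fixes N D :: "'a list \<Rightarrow> complex"
  assumes N_eq: "N w = avoiding_sum M D [] w"
    and N_rotate: "N (x # w) = N (w @ [x])"
begin

lemma N_Cons: "N (x # w) = avoiding_sum M D [x] w + gap_sum M (\<lambda>v h. D (x # v) * M h) [] w"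
  by (simp add: N_eq)

text \<open>On the circle \<open>x\<close> stands just before the prefix \<open>p\<close>. Unchosen,
  it lengthens the prefix; chosen, it makes \<open>p\<close> the beginning of the gap that follows
  it.\<close>

lemma avoiding_sum_snoc:
  "avoiding_sum M D p (w @ [x]) =
    avoiding_sum M D (x # p) w + gap_sum M (\<lambda>v h. D (v @ [x]) * M h) p w"
  by (induction w arbitrary: p)
     (simp_all add: gap_sum_append gap_sum_add M_Nil gap_sum_mult_left gap_sum_mult_right algebra_simps)

text \<open>The blocks avoiding \<open>x\<close> contribute equally to \<open>N (x # w)\<close> and
  \<open>N (w @ [x])\<close>. Hence so do the blocks containing \<open>x\<close>, and uniqueness
  applies.\<close>

lemma D_rotate1: "D (x # w) = D (w @ [x])"
proof -
  have "gap_sum M (\<lambda>v h. D (x # v) * M h) [] w = gap_sum M (\<lambda>v h. D (v @ [x]) * M h) [] w" for w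
    using N_rotate[of x w] by (simp add: N_Cons N_eq[of "w @ [x]"] avoiding_sum_snoc)
  from gap_sum_eq_imp[OF M_Nil this] show ?thesis .
qed

lemma D_rotate: "D (u @ w) = D (w @ u)"
  by (induction u arbitrary: w) (use D_rotate1 in auto)

text \<open>The prefix enters only through \<open>M\<close>. With \<open>l = 0\<close> the lemma
  allows replacing a prefix by one that \<open>M\<close> does not distinguish from it.\<close>

lemma avoiding_sum_linear:
  assumes "\<And>u w. M (u @ p @ w) = M (u @ q @ w) + l * M (u @ r @ w)"
  shows "avoiding_sum M D (p @ p') w = avoiding_sum M D (q @ p') w + l * avoiding_sum M D (r @ p') w"
proof (induction w arbitrary: p')
  case (Cons x w)
  then show ?case
    using assms
    by (simp add: distrib_left gap_sum_add mult.left_commute[of _ l] gap_sum_mult_left add_ac)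
qed simp

text \<open>The first entry is enough, since \<open>D_rotate\<close> brings any entry to the
  front.\<close>

lemma D_linear:
  assumes M: "\<And>u w. M (u @ c # w) = M (u @ a # w) + l * M (u @ b # w)"
    and N: "\<And>w. N (c # w) = N (a # w) + l * N (b # w)"
  shows "D (c # w) = D (a # w) + l * D (b # w)"
proof -
  have "gap_sum M (\<lambda>v h. D (c # v) * M h) [] w =
      gap_sum M (\<lambda>v h. (D (a # v) + l * D (b # v)) * M h) [] w" for w
    using N[of w] avoiding_sum_linear[of "[c]" "[a]" l "[b]" "[]" w] M
    by (simp add: N_Cons distrib_right distrib_left gap_sum_add mult.assoc gap_sum_mult_left)
  from gap_sum_eq_imp[OF M_Nil this] show ?thesis .
qed

text \<open>The cyclic product formula: each division of the circle into two arcs separating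
  \<open>a\<close> from \<open>b\<close> contributes twice, once for each choice of the arc that
  carries \<open>D\<close>.\<close>

lemma D_merge:
  assumes M: "\<And>u w. M (u @ [c] @ w) = M (u @ [a, b] @ w)"
    and N: "\<And>w. N (c # w) = N (a # b # w)"
  shows "D (c # w) = D (a # b # w) + (\<Sum>i\<le>length w. \<kappa> (b # take i w) * D (a # drop i w))
    + (\<Sum>i\<le>length w. D (b # take i w) * \<kappa> (drop i w @ [a]))"
proof -
  have "gap_sum M (\<lambda>v h. D (c # v) * M h) [] w =
      gap_sum M (\<lambda>v h. (D (a # b # v) + (\<Sum>i\<le>length v. \<kappa> (b # take i v) * D (a # drop i v))
      + (\<Sum>i\<le>length v. D (b # take i v) * \<kappa> (drop i v @ [a]))) * M h) [] w" for w
  proof -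
    \<comment> \<open>The distinguished block avoids both letters, contains only \<open>b\<close>,
      contains only \<open>a\<close>, or contains both.\<close>
    have "N (a # b # w) = avoiding_sum M D [a, b] w
        + gap_sum M (\<lambda>v h. D (b # v) * M (h @ [a])) [] w
        + gap_sum M (\<lambda>v h. D (a # v) * M h) [b] w + gap_sum M (\<lambda>v h. D (a # b # v) * M h) [] w"
      by (simp add: N_Cons M_Nil)
    moreover have "gap_sum M (\<lambda>v h. D (b # v) * M (h @ [a])) [] w =
        gap_sum M (\<lambda>v h. (\<Sum>i\<le>length v. D (b # take i v) * \<kappa> (drop i v @ [a])) * M h) [] w"
      by (simp add: M_snoc gap_sum_expand_last sum_distrib_right mult.assoc)
    moreover have "gap_sum M (\<lambda>v h. D (a # v) * M h) [b] w =
        gap_sum M (\<lambda>v h. (\<Sum>i\<le>length v. \<kappa> (b # take i v) * D (a # drop i v)) * M h) [] w"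
      by (rule gap_sum_expand_first[OF M_Cons'])
    moreover have "avoiding_sum M D [c] w = avoiding_sum M D [a, b] w"
      using avoiding_sum_linear[of "[c]" "[a, b]" 0 "[]" "[]" w] M by simp
    ultimately show ?thesis
      using N[of w] by (simp add: N_Cons distrib_right gap_sum_add)
  qed
  from gap_sum_eq_imp[OF M_Nil this] show ?thesis .
qed

end

section \<open>Cumulants with a unit entry\<close>

context moment_cumulant
begin

text \<open>Merging \<open>e\<close> with a neighbour \<open>b\<close> gives back \<open>b\<close>.
  In the product formula all products vanish by induction except the one where \<open>e\<close> is a
  block of its own, and that one cancels the left-hand side.\<close>

lemma cumulant_unit:
  assumes e: "\<And>u w. M (u @ e # w) = M (u @ w)"
    and "u \<noteq> [] \<or> w \<noteq> []"
  shows "\<kappa> (u @ e # w) = 0"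
  using assms(2)
proof (induction "length u + length w" arbitrary: u w rule: less_induct)
  case less
  have single: "\<kappa> [e] = 1"
    using e[of "[]" "[]"] M_Nil by (simp add: cumulant_single)
  show ?case
  proof (cases w)
    case (Cons b w')
    \<comment> \<open>For empty \<open>u\<close> the singleton block of \<open>e\<close> appears in
      the first sum at \<open>i = length w'\<close>; otherwise it appears in the second sum, see
      \<open>z2\<close>.\<close>
    have z1: "\<kappa> (u @ e # drop i w') = (if u = [] \<and> i = length w' then 1 else 0)" if "i \<le> length w'" for i
    proof (cases "u = [] \<and> i = length w'")
      case False
      with that have "u \<noteq> [] \<or> drop i w' \<noteq> []" by auto
      then show ?thesis using less(1)[of u "drop i w'"] False Cons by auto
    qed (simp add: single)
    have z2: "\<kappa> (drop (Suc i) u @ [e]) = (if Suc i = length u then 1 else 0)" if "i < length u" for i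
    proof (cases "Suc i = length u")
      case False
      with that have "drop (Suc i) u \<noteq> []" by auto
      then show ?thesis using less(1)[of "drop (Suc i) u" "[]"] False that Cons by auto
    qed (simp add: single)
    have "(\<Sum>i\<le>length w'. \<kappa> (b # take i w') * \<kappa> (u @ e # drop i w')) =
        (\<Sum>i\<le>length w'. if i = length w' then (if u = [] then \<kappa> (b # w') else 0) else 0)"
      by (intro sum.cong) (simp_all add: z1)
    moreover have "(\<Sum>i<length u. \<kappa> (take (Suc i) u @ b # w') * \<kappa> (drop (Suc i) u @ [e])) =
        (\<Sum>i<length u. if i = length u - 1 then \<kappa> (u @ b # w') else 0)"
      by (intro sum.cong) (auto simp: z2)
    moreover have "\<kappa> (u @ b # w') = \<kappa> (u @ e # b # w')
        + (\<Sum>i\<le>length w'. \<kappa> (b # take i w') * \<kappa> (u @ e # drop i w'))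
        + (\<Sum>i<length u. \<kappa> (take (Suc i) u @ b # w') * \<kappa> (drop (Suc i) u @ [e]))"
      by (rule cumulant_merge) (use e in simp)
    ultimately show ?thesis
      using Cons by (cases "u = []") auto
  next
    case Nil
    \<comment> \<open>As the last letter, \<open>e\<close> is merged with the letter before
      it.\<close>
    then obtain u' a where u: "u = u' @ [a]" using less(2) by (cases u rule: rev_cases) auto
    have z: "\<kappa> (take (Suc i) u' @ [e]) = 0" if "i < length u'" for i
      using that less(1)[of "take (Suc i) u'" "[]"] u Nil by (cases u') auto
    have "\<kappa> (u' @ [a]) = \<kappa> (u' @ a # [e])
        + (\<Sum>i\<le>length []. \<kappa> (e # take i []) * \<kappa> (u' @ a # drop i []))
        + (\<Sum>i<length u'. \<kappa> (take (Suc i) u' @ e # []) * \<kappa> (drop (Suc i) u' @ [a]))"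
      using cumulant_merge[of a a e u' "[]"] e[of "_ @ [_]"] by simp
    then show ?thesis using Nil u by (simp add: single z)
  qed
qed

end

context cyclic_moment_cumulant
begin

text \<open>The same cancellation as for free cumulants. A single entry is no exception here,
  because \<open>N [e] = N [] = 0\<close>.\<close>

lemma D_unit:
  assumes e: "\<And>u w. M (u @ e # w) = M (u @ w)" and N: "\<And>w. N (e # w) = N w"
  shows "D (e # w) = 0"
proof (induction w rule: length_induct)
  case (1 w)
  show ?case
  proof (cases w)
    case Nil
    then show ?thesis using N[of "[]"] by (simp add: N_eq M_Nil)
  next
    case (Cons b w')
    have "\<kappa> (drop i w' @ [e]) = (if i = length w' then 1 else 0)" if "i \<le> length w'" for i
    proof (cases "i = length w'")
      case True
      then show ?thesis using e[of "[]" "[]"] M_Nil by (simp add: cumulant_single)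
    next
      case False
      then show ?thesis using that cumulant_unit[OF e, of "drop i w'" "[]"] by simp
    qed
    then have "(\<Sum>i\<le>length w'. D (b # take i w') * \<kappa> (drop i w' @ [e])) =
        (\<Sum>i\<le>length w'. if i = length w' then D (b # w') else 0)"
      by (intro sum.cong) auto
    moreover have "D (b # w') = D (e # b # w')
        + (\<Sum>i\<le>length w'. \<kappa> (b # take i w') * D (e # drop i w'))
        + (\<Sum>i\<le>length w'. D (b # take i w') * \<kappa> (drop i w' @ [e]))"
      by (rule D_merge) (use e N in auto)
    moreover have "(\<Sum>i\<le>length w'. \<kappa> (b # take i w') * D (e # drop i w')) = 0"
      using 1 Cons by (intro sum.neutral) (simp add: less_Suc_eq_le)
    ultimately show ?thesis using Cons by simp
  qed
qed

end

section \<open>Non-crossing partitions containing a given block\<close>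

definition NC_on :: "nat set \<Rightarrow> nat set set set" where
  "NC_on S = {\<pi>. partition_on S \<pi> \<and> noncrossing \<pi>}"

text \<open>For \<open>k\<close> outside \<open>V\<close>, the first element of \<open>V\<close> met
  when walking back from \<open>k\<close> on the circle; the second branch is the walk past
  0.\<close>

definition cyclic_pred :: "nat set \<Rightarrow> nat \<Rightarrow> nat" where
  "cyclic_pred V k = (if \<exists>u\<in>V. u < k then Max {u \<in> V. u < k} else Max V)"

text \<open>The set underlying \<open>arc n V v\<close>, see \<open>set_arc\<close>. Described by
  predecessors, different arcs are visibly disjoint.\<close>

definition arc_set :: "nat \<Rightarrow> nat set \<Rightarrow> nat \<Rightarrow> nat set" where
  "arc_set n V v = {k \<in> {..<n} - V. cyclic_pred V k = v}"

text \<open>Relevant only below \<open>Max V\<close>; the arc after the maximum wraps around and is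
  treated separately.\<close>

definition next_in :: "nat set \<Rightarrow> nat \<Rightarrow> nat" where
  "next_in V v = Min {u \<in> V. v < u}"

lemma finite_NC_on: "finite S \<Longrightarrow> finite (NC_on S)"
  by (rule finite_subset[of _ "Pow (Pow S)"]) (auto simp: NC_on_def partition_on_def)

lemma finite_arc_set [simp]: "finite (arc_set n V v)"
  by (simp add: arc_set_def)

lemma noncrossingD:
  "noncrossing \<pi> \<Longrightarrow> V \<in> \<pi> \<Longrightarrow> W \<in> \<pi> \<Longrightarrow> a < b \<Longrightarrow> b < c \<Longrightarrow> c < d \<Longrightarrow>
    a \<in> V \<Longrightarrow> c \<in> V \<Longrightarrow> b \<in> W \<Longrightarrow> d \<in> W \<Longrightarrow> V = W"
  unfolding noncrossing_def by blast

lemma takeWhile_upt: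
  assumes "a \<le> m" "m < b" "m \<in> V" "\<And>k. a \<le> k \<Longrightarrow> k < m \<Longrightarrow> k \<notin> V"
  shows "takeWhile (\<lambda>k. k \<notin> V) [a..<b] = [a..<m]"
proof -
  have "[a..<b] = [a..<m] @ m # [Suc m..<b]"
    using assms upt_add_eq_append[of a m "b - m"] upt_conv_Cons[of m b] by simp
  then show ?thesis
    using assms by (simp add: takeWhile_append)
qed

context
  fixes n :: nat and V :: "nat set"
  assumes V: "V \<subseteq> {..<n}" "V \<noteq> {}"
begin

lemma finite_block: "finite V"
  using V(1) finite_subset by blast

lemma cyclic_pred_in: "cyclic_pred V k \<in> V"
proof (cases "\<exists>u\<in>V. u < k")
  case True
  then have "{u \<in> V. u < k} \<noteq> {}" by auto
  from Max_in[OF _ this] finite_block show ?thesis using True by (auto simp: cyclic_pred_def)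
qed (use V finite_block in \<open>simp add: cyclic_pred_def\<close>)

lemma cyclic_pred_cases:
  obtains "cyclic_pred V k < k" "\<And>u. u \<in> V \<Longrightarrow> u < k \<Longrightarrow> u \<le> cyclic_pred V k"
  | "\<And>u. u \<in> V \<Longrightarrow> k \<le> u" "\<And>u. u \<in> V \<Longrightarrow> u \<le> cyclic_pred V k"
proof (cases "\<exists>u\<in>V. u < k")
  case True
  then have "{u \<in> V. u < k} \<noteq> {}" by auto
  from Max_in[OF _ this] finite_block True have "cyclic_pred V k < k" by (auto simp: cyclic_pred_def)
  moreover have "u \<le> cyclic_pred V k" if "u \<in> V" "u < k" for u
    using True that finite_block by (auto simp: cyclic_pred_def)
  ultimately show ?thesis using that(1) by blast
next
  case False
  then have "u \<le> cyclic_pred V k" if "u \<in> V" for u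
    using that finite_block by (auto simp: cyclic_pred_def)
  moreover have "k \<le> u" if "u \<in> V" for u
    using False that by force
  ultimately show ?thesis using that(2) by blast
qed

lemma disjoint_arc_sets: "v \<noteq> v' \<Longrightarrow> arc_set n V v \<inter> arc_set n V v' = {}"
  by (auto simp: arc_set_def)

lemma UN_arc_set: "(\<Union>v\<in>V. arc_set n V v) = {..<n} - V"
  using cyclic_pred_in by (auto simp: arc_set_def)

text \<open>The two positions cut the circle into the interval between them and the rest. They share
  an arc of \<open>V\<close> as long as \<open>V\<close> meets only one of these pieces.\<close>

lemma cyclic_pred_eq_iff:
  assumes k: "k < k'" "k \<notin> V" "k' \<notin> V"
  shows "cyclic_pred V k = cyclic_pred V k' \<longleftrightarrow>
    (\<forall>u\<in>V. \<not> (k < u \<and> u < k')) \<or> (\<forall>u\<in>V. k < u \<and> u < k')"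
proof
  assume eq: "cyclic_pred V k = cyclic_pred V k'"
  show "(\<forall>u\<in>V. \<not> (k < u \<and> u < k')) \<or> (\<forall>u\<in>V. k < u \<and> u < k')"
  proof (rule ccontr)
    assume "\<not> ?thesis"
    then obtain u u' where u: "u \<in> V" "k < u" "u < k'" and u': "u' \<in> V" "\<not> (k < u' \<and> u' < k')"
      by blast
    have k': "cyclic_pred V k' < k'" "u \<le> cyclic_pred V k'"
      by (cases k' rule: cyclic_pred_cases; use u in force)+
    show False
    proof (cases k rule: cyclic_pred_cases)
      case 1
      then show False using eq k' u by simp
    next
      case 2
      then have "k \<le> u'" "u' \<le> cyclic_pred V k" using u' by auto
      moreover have "k \<noteq> u'" using u' k by auto
      ultimately show False using u' eq k' by simp
    qed
  qed
next
  assume "(\<forall>u\<in>V. \<not> (k < u \<and> u < k')) \<or> (\<forall>u\<in>V. k < u \<and> u < k')"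
  then show "cyclic_pred V k = cyclic_pred V k'"
  proof
    assume none: "\<forall>u\<in>V. \<not> (k < u \<and> u < k')"
    have "u < k \<longleftrightarrow> u < k'" if "u \<in> V" for u
      using that k none by (metis linorder_neqE_nat order.strict_trans)
    then have "{u \<in> V. u < k} = {u \<in> V. u < k'}" "(\<exists>u\<in>V. u < k) \<longleftrightarrow> (\<exists>u\<in>V. u < k')"
      by auto
    then show ?thesis by (simp add: cyclic_pred_def)
  next
    assume all: "\<forall>u\<in>V. k < u \<and> u < k'"
    then have "\<not> (\<exists>u\<in>V. u < k)" by (meson order.asym)
    moreover have "\<exists>u\<in>V. u < k'" using all V(2) by blast
    moreover have "{u \<in> V. u < k'} = V" using all by blast
    ultimately show ?thesis by (simp add: cyclic_pred_def)
  qed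
qed

lemma cyclic_pred_eqD:
  assumes "cyclic_pred V k = cyclic_pred V k'" "k \<notin> V" "k' \<notin> V" "u \<in> V" "k < u" "u < k'" "u' \<in> V"
  shows "k < u'" "u' < k'"
proof -
  have "k < k'" using assms by simp
  from cyclic_pred_eq_iff[OF this assms(2,3)] assms show "k < u'" "u' < k'" by auto
qed

text \<open>An element of \<open>V\<close> between \<open>w\<close> and \<open>w'\<close> together
  with one outside this interval would make \<open>V\<close> and \<open>W\<close> cross.\<close>

lemma cyclic_pred_same_block:
  assumes \<pi>: "\<pi> \<in> NC n" "V \<in> \<pi>" "W \<in> \<pi>" "W \<noteq> V" and w: "w \<in> W" "w' \<in> W"
  shows "cyclic_pred V w = cyclic_pred V w'"
proof -
  have dis: "W \<inter> V = {}"
    using \<pi> by (auto simp: NC_def partition_on_def disjoint_def)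
  have nc: "noncrossing \<pi>" using \<pi> by (simp add: NC_def)
  have *: "cyclic_pred V w = cyclic_pred V w'" if w: "w \<in> W" "w' \<in> W" and "w < w'" for w w'
  proof -
    have "w < u' \<and> u' < w'" if u: "u \<in> V" "w < u" "u < w'" and u': "u' \<in> V" for u u'
    proof (rule ccontr)
      assume "\<not> ?thesis"
      moreover have "u' \<noteq> w" "u' \<noteq> w'" using dis u' w by auto
      ultimately consider "u' < w" | "w' < u'" by linarith
      then show False
      proof cases
        case 1
        then have "V = W"
          using noncrossingD[OF nc \<pi>(2,3), of u' w u w'] u u' w by blast
        then show False using \<pi>(4) by simp
      next
        case 2
        then have "W = V"
          using noncrossingD[OF nc \<pi>(3,2), of w u w' u'] u u' w by blast
        then show False using \<pi>(4) by simp
      qed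
    qed
    then have "(\<forall>u\<in>V. \<not> (w < u \<and> u < w')) \<or> (\<forall>u\<in>V. w < u \<and> u < w')"
      by blast
    moreover have "w \<notin> V" "w' \<notin> V" using dis w by auto
    ultimately show ?thesis
      using cyclic_pred_eq_iff[OF \<open>w < w'\<close>] by simp
  qed
  consider "w < w'" | "w = w'" | "w' < w" by linarith
  then show ?thesis
  proof cases
    case 1
    with w show ?thesis by (rule *)
  next
    case 3
    with w have "cyclic_pred V w' = cyclic_pred V w" by (intro *)
    then show ?thesis ..
  qed simp
qed

lemma block_in_arc_set:
  assumes \<pi>: "\<pi> \<in> NC n" "V \<in> \<pi>" "W \<in> \<pi>" "W \<noteq> V"
  shows "\<exists>v\<in>V. W \<subseteq> arc_set n V v"
proof -
  have W: "W \<subseteq> {..<n} - V" "W \<noteq> {}"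
    using \<pi> by (auto simp: NC_def partition_on_def disjoint_def)
  then obtain w where w: "w \<in> W" by blast
  have "k \<in> arc_set n V (cyclic_pred V w)" if "k \<in> W" for k
    using cyclic_pred_same_block[OF \<pi> that w] W(1) that by (auto simp: arc_set_def)
  then show ?thesis using cyclic_pred_in by blast
qed

lemma noncrossing_insert:
  assumes s: "\<And>v. v \<in> V \<Longrightarrow> s v \<in> NC_on (arc_set n V v)"
  shows "noncrossing (insert V (\<Union>v\<in>V. s v))"
  unfolding noncrossing_def
proof (intro ballI allI impI)
  fix X Y a b c d
  assume X: "X \<in> insert V (\<Union>v\<in>V. s v)" and Y: "Y \<in> insert V (\<Union>v\<in>V. s v)"
    and *: "a < b \<and> b < c \<and> c < d \<and> a \<in> X \<and> c \<in> X \<and> b \<in> Y \<and> d \<in> Y"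
  have sub: "Z = V \<or> (\<exists>v\<in>V. Z \<in> s v \<and> Z \<subseteq> arc_set n V v)" if Z: "Z \<in> insert V (\<Union>v\<in>V. s v)" for Z
  proof (cases "Z = V")
    case False
    then obtain v where v: "v \<in> V" "Z \<in> s v" using Z by blast
    then have "\<Union>(s v) = arc_set n V v" using s by (simp add: NC_on_def partition_on_def)
    then show ?thesis using v by blast
  qed simp
  show "X = Y"
  proof (cases "X = V \<or> Y = V")
    case True
    \<comment> \<open>An element \<open>c\<close> of \<open>V\<close> between two points of one arc
      forces all of \<open>V\<close> between them, against \<open>a < b\<close>.\<close>
    have False if Y: "Y \<subseteq> arc_set n V v" and "X = V" for v
    proof -
      have "cyclic_pred V b = cyclic_pred V d" "b \<notin> V" "d \<notin> V"
        using subsetD[OF Y, of b] subsetD[OF Y, of d] * by (simp_all add: arc_set_def)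
      then have "b < a"
        by (rule cyclic_pred_eqD(1)[where u = c]) (use * \<open>X = V\<close> in auto)
      then show False using * by auto
    qed
    moreover have False if X: "X \<subseteq> arc_set n V v" and "Y = V" for v
    proof -
      have "cyclic_pred V a = cyclic_pred V c" "a \<notin> V" "c \<notin> V"
        using subsetD[OF X, of a] subsetD[OF X, of c] * by (simp_all add: arc_set_def)
      then have "d < c"
        by (rule cyclic_pred_eqD(2)[where u = b]) (use * \<open>Y = V\<close> in auto)
      then show False using * by auto
    qed
    ultimately show ?thesis
      using True sub[OF X] sub[OF Y] by blast
  next
    case False
    then obtain v v' where v: "v \<in> V" "X \<in> s v" "X \<subseteq> arc_set n V v"
      and v': "v' \<in> V" "Y \<in> s v'" "Y \<subseteq> arc_set n V v'"
      using sub[OF X] sub[OF Y] by blast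
    have p: "cyclic_pred V a = v" "cyclic_pred V c = v" "cyclic_pred V b = v'" "cyclic_pred V d = v'"
      and nV: "a \<notin> V" "b \<notin> V" "c \<notin> V" "d \<notin> V"
      using subsetD[OF v(3), of a] subsetD[OF v(3), of c] subsetD[OF v'(3), of b]
        subsetD[OF v'(3), of d] * by (simp_all add: arc_set_def)
    have less: "a < b" "b < c" "c < d" "a < c" "b < d" using * by auto
    \<comment> \<open>Otherwise some \<open>u\<close> in \<open>V\<close> separates \<open>a\<close>
      from \<open>b\<close>. As \<open>a\<close> and \<open>c\<close> share an arc, all of
      \<open>V\<close> then lies between them, so nothing separates \<open>c\<close> from
      \<open>d\<close>.\<close>
    have "v = v'"
    proof (rule ccontr)
      assume "v \<noteq> v'"
      then obtain u where u: "u \<in> V" "a < u" "u < b"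
        using cyclic_pred_eq_iff[OF less(1) nV(1,2)] p by auto
      have "u' < c" if "u' \<in> V" for u'
        using cyclic_pred_eqD(2)[of a c u u'] p nV u that less by simp
      then have "\<forall>u\<in>V. \<not> (c < u \<and> u < d)" by (auto dest: less_asym)
      then show False
        using cyclic_pred_eq_iff[OF less(3) nV(3,4)] p \<open>v \<noteq> v'\<close> by simp
    qed
    then have "noncrossing (s v)" "Y \<in> s v"
      using s[OF v(1)] v' by (auto simp: NC_on_def)
    then show ?thesis
      using noncrossingD[of "s v" X Y a b c d] v * by blast
  qed
qed

text \<open>Once \<open>V\<close> is fixed, the rest of the partition is an independent choice of a
  non-crossing partition on every arc. The sum over such families factors.\<close>

lemma sum_NC_containing_block:
  fixes f :: "nat set \<Rightarrow> complex"
  shows "(\<Sum>\<pi> | \<pi> \<in> NC n \<and> V \<in> \<pi>. \<Prod>W\<in>\<pi> - {V}. f W) =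
    (\<Prod>v\<in>V. \<Sum>\<sigma>\<in>NC_on (arc_set n V v). \<Prod>W\<in>\<sigma>. f W)"
proof -
  let ?T = "arc_set n V"
  have S: "\<Union>(s v) = ?T v" "{} \<notin> s v" "disjoint (s v)" if "s \<in> PiE V (\<lambda>v. NC_on (?T v))" "v \<in> V" for s v
    using that by (auto simp: NC_on_def partition_on_def PiE_def Pi_def)
  have Tn: "X = {}" if "X \<subseteq> ?T v" "X \<subseteq> ?T v'" "v \<noteq> v'" for X v v'
    using that disjoint_arc_sets by blast
  have TV: "X = {}" if "X \<subseteq> ?T v" "X \<subseteq> V" for X v
    using that by (auto simp: arc_set_def)
  have fin: "finite (s v)" if "s \<in> PiE V (\<lambda>v. NC_on (?T v))" "v \<in> V" for s v
    using S(1)[OF that] by (intro finite_UnionD) simp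
  have notV: "V \<notin> (\<Union>v\<in>V. s v)" if "s \<in> PiE V (\<lambda>v. NC_on (?T v))" for s
  proof
    assume "V \<in> (\<Union>v\<in>V. s v)"
    then obtain v where v: "v \<in> V" "V \<in> s v" by blast
    then have "V \<subseteq> ?T v" using S(1)[OF that v(1)] by blast
    then show False using TV V(2) by blast
  qed
  have "(\<Sum>\<pi> | \<pi> \<in> NC n \<and> V \<in> \<pi>. \<Prod>W\<in>\<pi> - {V}. f W) =
      (\<Sum>s\<in>PiE V (\<lambda>v. NC_on (?T v)). \<Prod>v\<in>V. \<Prod>W\<in>s v. f W)"
  proof (rule sum.reindex_bij_witness[where i = "\<lambda>s. insert V (\<Union>v\<in>V. s v)"
        and j = "\<lambda>\<pi>. \<lambda>v\<in>V. {W \<in> \<pi>. W \<subseteq> ?T v}"])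
    fix \<pi> assume "\<pi> \<in> {\<pi>. \<pi> \<in> NC n \<and> V \<in> \<pi>}"
    then have \<pi>: "\<pi> \<in> NC n" "V \<in> \<pi>" by auto
    then have p: "\<Union>\<pi> = {..<n}" "disjoint \<pi>" "{} \<notin> \<pi>" "noncrossing \<pi>"
      by (auto simp: NC_def partition_on_def)
    show eq: "insert V (\<Union>v\<in>V. (\<lambda>v\<in>V. {W \<in> \<pi>. W \<subseteq> ?T v}) v) = \<pi>"
      using block_in_arc_set[OF \<pi>] \<pi>(2) by auto
    have "{W \<in> \<pi>. W \<subseteq> ?T v} \<in> NC_on (?T v)" if v: "v \<in> V" for v
    proof -
      have "k \<in> \<Union>{W \<in> \<pi>. W \<subseteq> ?T v}" if k: "k \<in> ?T v" for k
      proof -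
        obtain W where W: "W \<in> \<pi>" "k \<in> W" using p(1) k by (auto simp: arc_set_def)
        then have "W \<noteq> V" using k by (auto simp: arc_set_def)
        with block_in_arc_set[OF \<pi> W(1)] obtain v' where "v' \<in> V" "W \<subseteq> ?T v'" by blast
        moreover from this have "v' = v" using k W disjoint_arc_sets by blast
        ultimately show ?thesis using W by blast
      qed
      then show ?thesis
        using p by (auto simp: NC_on_def partition_on_def disjoint_def noncrossing_def)
    qed
    then show j: "(\<lambda>v\<in>V. {W \<in> \<pi>. W \<subseteq> ?T v}) \<in> PiE V (\<lambda>v. NC_on (?T v))"
      by auto
    let ?s = "\<lambda>v\<in>V. {W \<in> \<pi>. W \<subseteq> ?T v}"
    have "(\<Prod>W\<in>(\<Union>v\<in>V. ?s v). f W) = (\<Prod>v\<in>V. \<Prod>W\<in>?s v. f W)"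
    proof (rule prod.UNION_disjoint)
      show "\<forall>v\<in>V. \<forall>v'\<in>V. v \<noteq> v' \<longrightarrow> ?s v \<inter> ?s v' = {}"
        using Tn p(3) by auto
    qed (use finite_block fin[OF j] in auto)
    moreover have "(\<Union>v\<in>V. ?s v) = \<pi> - {V}"
      using eq notV[OF j] by blast
    ultimately show "(\<Prod>v\<in>V. \<Prod>W\<in>?s v. f W) = (\<Prod>W\<in>\<pi> - {V}. f W)" by simp
  next
    fix s assume s: "s \<in> PiE V (\<lambda>v. NC_on (?T v))"
    have sv: "W \<subseteq> ?T v" if "v \<in> V" "W \<in> s v" for v W
      using S(1)[OF s] that by blast
    \<comment> \<open>Blocks are nonempty and arcs disjoint, so a block inside an arc comes from the
      partition of that very arc.\<close>
    have vs: "W \<in> s v" if "v \<in> V" "W \<subseteq> ?T v" and W: "W \<in> insert V (\<Union>v\<in>V. s v)" for W v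
    proof -
      have "W \<noteq> V" using TV[OF that(2)] V by auto
      with W obtain v' where v': "v' \<in> V" "W \<in> s v'" by auto
      then have "W \<noteq> {}" using S(2)[OF s] by metis
      then have "v' = v" using Tn[OF sv[OF v'] that(2)] by blast
      then show ?thesis using v' by simp
    qed
    show "(\<lambda>v\<in>V. {W \<in> insert V (\<Union>v\<in>V. s v). W \<subseteq> ?T v}) = s"
    proof (rule ext)
      fix v
      show "(\<lambda>v\<in>V. {W \<in> insert V (\<Union>v\<in>V. s v). W \<subseteq> ?T v}) v = s v"
      proof (cases "v \<in> V")
        case True
        have "{W \<in> insert V (\<Union>v\<in>V. s v). W \<subseteq> ?T v} = s v"
        proof
          show "{W \<in> insert V (\<Union>v\<in>V. s v). W \<subseteq> ?T v} \<subseteq> s v" using vs[OF True] by blast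
          show "s v \<subseteq> {W \<in> insert V (\<Union>v\<in>V. s v). W \<subseteq> ?T v}" using sv[OF True] True by blast
        qed
        then show ?thesis using True by simp
      qed (simp add: PiE_arb[OF s])
    qed
    have "partition_on {..<n} (insert V (\<Union>v\<in>V. s v))"
    proof (rule partition_onI)
      show "\<Union> (insert V (\<Union>v\<in>V. s v)) = {..<n}"
      proof -
        have "\<Union> (insert V (\<Union>v\<in>V. s v)) = V \<union> (\<Union>v\<in>V. \<Union>(s v))" by auto
        also have "\<dots> = V \<union> (\<Union>v\<in>V. ?T v)" using S(1)[OF s] by simp
        also have "\<dots> = {..<n}" using UN_arc_set V(1) by auto
        finally show ?thesis .
      qed
      show "{} \<notin> insert V (\<Union>v\<in>V. s v)"
        using S(2)[OF s] V(2) by auto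
      fix X Y assume XY: "X \<in> insert V (\<Union>v\<in>V. s v)" "Y \<in> insert V (\<Union>v\<in>V. s v)" "X \<noteq> Y"
      show "disjnt X Y"
      proof (cases "X = V \<or> Y = V")
        case True
        then show ?thesis
        proof (elim disjE)
          assume "X = V"
          then obtain v where "v \<in> V" "Y \<subseteq> ?T v" using XY sv by blast
          then show ?thesis using \<open>X = V\<close> by (auto simp: disjnt_def arc_set_def)
        next
          assume "Y = V"
          then obtain v where "v \<in> V" "X \<subseteq> ?T v" using XY sv by blast
          then show ?thesis using \<open>Y = V\<close> by (auto simp: disjnt_def arc_set_def)
        qed
      next
        case False
        then obtain v v' where v: "v \<in> V" "X \<in> s v" "v' \<in> V" "Y \<in> s v'" using XY by auto
        show ?thesis
        proof (cases "v = v'")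
          case True
          then show ?thesis using S(3)[OF s v(1)] v XY(3) by (auto simp: disjoint_def disjnt_def)
        next
          case False
          then show ?thesis using sv[OF v(1,2)] sv[OF v(3,4)] disjoint_arc_sets
            unfolding disjnt_def by blast
        qed
      qed
    qed
    moreover have "noncrossing (insert V (\<Union>v\<in>V. s v))"
      using s by (intro noncrossing_insert) auto
    ultimately show "insert V (\<Union>v\<in>V. s v) \<in> {\<pi>. \<pi> \<in> NC n \<and> V \<in> \<pi>}"
      by (simp add: NC_def)
  qed
  also have "\<dots> = (\<Prod>v\<in>V. \<Sum>\<sigma>\<in>NC_on (?T v). \<Prod>W\<in>\<sigma>. f W)"
    using finite_block finite_NC_on by (intro prod_sum_PiE[symmetric]) auto
  finally show ?thesis .
qed

section \<open>Arcs as lists of positions\<close>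

lemma Max_block: "Max V \<in> V" "Max V < n"
  using Max_in[OF finite_block V(2)] V(1) by auto

lemma next_in_props:
  assumes "v \<in> V" "v \<noteq> Max V"
  shows "next_in V v \<in> V" "v < next_in V v" "\<And>u. u \<in> V \<Longrightarrow> v < u \<Longrightarrow> next_in V v \<le> u"
proof -
  have "v < Max V" using assms finite_block by (simp add: order_less_le)
  then have "{u \<in> V. v < u} \<noteq> {}" using Max_block by auto
  then show "next_in V v \<in> V" "v < next_in V v"
    using Min_in[of "{u \<in> V. v < u}"] finite_block by (auto simp: next_in_def)
  show "next_in V v \<le> u" if "u \<in> V" "v < u" for u
    using that finite_block by (simp add: next_in_def)
qed

lemma arc_not_Max:
  assumes "v \<in> V" "v \<noteq> Max V"
  shows "arc n V v = [Suc v..<next_in V v]"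
proof -
  note p = next_in_props[OF assms]
  have n: "next_in V v < n" using p(1) V(1) by auto
  have "next_in V v \<in> set [Suc v..<n]" using p(2) n by auto
  then have "arc n V v = takeWhile (\<lambda>k. k \<notin> V) [Suc v..<n]"
    unfolding arc_def by (rule takeWhile_append1) (use p(1) in simp)
  also have "\<dots> = [Suc v..<next_in V v]"
    using p n by (intro takeWhile_upt) (auto simp: Suc_le_eq not_le[symmetric])
  finally show ?thesis .
qed

lemma arc_Max: "arc n V (Max V) = [Suc (Max V)..<n] @ [0..<Min V]"
proof -
  have "k \<notin> V" if "k \<in> set [Suc (Max V)..<n]" for k
    using that Max_ge[OF finite_block, of k] by auto
  then have "arc n V (Max V) = [Suc (Max V)..<n] @ takeWhile (\<lambda>k. k \<notin> V) [0..<Max V]"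
    unfolding arc_def by (intro takeWhile_append2)
  also have "takeWhile (\<lambda>k. k \<notin> V) [0..<Max V] = [0..<Min V]"
  proof -
    have less: "k \<notin> V" if "k < Min V" for k
      using that Min_le[OF finite_block, of k] by auto
    have "Min V \<in> V" using Min_in[OF finite_block V(2)] .
    then have "Min V \<le> Max V" using finite_block by simp
    then consider "Min V = Max V" | "Min V < Max V" by linarith
    then show ?thesis
    proof cases
      \<comment> \<open>For a singleton block nothing stops the walk, and the arc consists of all
        other positions.\<close>
      case 1
      then show ?thesis using less by (simp add: takeWhile_eq_all_conv)
    next
      case 2
      with \<open>Min V \<in> V\<close> less show ?thesis by (intro takeWhile_upt) auto
    qed
  qed
  finally show ?thesis .
qed

lemma set_arc:
  assumes "v \<in> V"
  shows "set (arc n V v) = arc_set n V v"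
proof (cases "v = Max V")
  case True
  have *: "Max V < k \<and> k < n \<or> k < Min V \<longleftrightarrow> k < n \<and> k \<notin> V \<and> cyclic_pred V k = Max V" for k
  proof
    assume k: "Max V < k \<and> k < n \<or> k < Min V"
    then show "k < n \<and> k \<notin> V \<and> cyclic_pred V k = Max V"
    proof
      assume k: "Max V < k \<and> k < n"
      then have "{u \<in> V. u < k} = V"
        using finite_block Max_ge order.strict_trans1 by blast
      moreover have "k \<notin> V" using k finite_block Max_ge leD by blast
      ultimately show ?thesis
        using k Max_block by (auto simp: cyclic_pred_def)
    next
      assume k: "k < Min V"
      then have less: "k < u" if "u \<in> V" for u
        using Min_le[OF finite_block that] by simp
      then have "\<not> (\<exists>u\<in>V. u < k)" "k \<notin> V" "k < n" using Max_block by (auto simp: not_less less_imp_le intro: less_trans)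
      then show ?thesis by (simp add: cyclic_pred_def)
    qed
  next
    assume k: "k < n \<and> k \<notin> V \<and> cyclic_pred V k = Max V"
    show "Max V < k \<and> k < n \<or> k < Min V"
    proof (cases k rule: cyclic_pred_cases)
      case 1
      then show ?thesis using k by simp
    next
      case 2
      have "Min V \<in> V" using Min_in[OF finite_block V(2)] .
      with 2(1)[of "Min V"] k show ?thesis by (cases "k = Min V") auto
    qed
  qed
  show ?thesis
  proof (rule set_eqI)
    show "k \<in> set (arc n V v) \<longleftrightarrow> k \<in> arc_set n V v" for k
      using *[of k] by (simp add: True arc_Max arc_set_def Suc_le_eq)
  qed
next
  case False
  note p = next_in_props[OF assms False]
  have n: "next_in V v < n" using p(1) V(1) by auto
  have *: "v < k \<and> k < next_in V v \<longleftrightarrow> k < n \<and> k \<notin> V \<and> cyclic_pred V k = v" for k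
  proof
    assume k: "v < k \<and> k < next_in V v"
    then have "k \<notin> V" using p(3)[of k] by auto
    moreover have "Max {u \<in> V. u < k} = v"
    proof (rule Max_eqI)
      show "u \<le> v" if "u \<in> {u \<in> V. u < k}" for u
        using that k p(3)[of u] by (cases "v < u") auto
    qed (use k assms finite_block in auto)
    ultimately show "k < n \<and> k \<notin> V \<and> cyclic_pred V k = v"
      using k n assms by (auto simp: cyclic_pred_def)
  next
    assume k: "k < n \<and> k \<notin> V \<and> cyclic_pred V k = v"
    show "v < k \<and> k < next_in V v"
    proof (cases k rule: cyclic_pred_cases)
      case 1
      have "k \<noteq> next_in V v" using k p(1) by auto
      moreover have "\<not> next_in V v < k" using 1(2)[OF p(1)] k p(2) by auto
      ultimately show ?thesis using 1(1) k by simp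
    next
      case 2
      from 2(2)[OF Max_block(1)] have "v = Max V" using k Max_ge[OF finite_block assms] by simp
      then show ?thesis using False by simp
    qed
  qed
  show ?thesis
  proof (rule set_eqI)
    show "k \<in> set (arc n V v) \<longleftrightarrow> k \<in> arc_set n V v" for k
      using *[of k] by (simp add: arc_not_Max[OF assms False] arc_set_def Suc_le_eq)
  qed
qed

text \<open>The common shape of both kinds of arcs: an interval followed by an initial segment,
  which is empty unless the arc passes 0. If 0 is in \<open>V\<close>, no arc does.\<close>

lemma arc_form:
  assumes "v \<in> V"
  obtains a b k where "arc n V v = [a..<b] @ [0..<k]" "k \<le> a" "a \<le> b" "b \<le> n" "0 \<in> V \<Longrightarrow> k = 0"
proof (cases "v = Max V")
  case True
  show thesis
  proof (rule that)
    show "arc n V v = [Suc (Max V)..<n] @ [0..<Min V]" using True arc_Max by simp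
    show "Min V \<le> Suc (Max V)" using Max_block finite_block by (simp add: le_SucI)
    show "Suc (Max V) \<le> n" using Max_block by simp
    show "Min V = 0" if "0 \<in> V" using Min_le[OF finite_block that] by simp
  qed simp
next
  case False
  show thesis
  proof (rule that)
    show "arc n V v = [Suc v..<next_in V v] @ [0..<0]" using arc_not_Max[OF assms False] by simp
    show "Suc v \<le> next_in V v" "next_in V v \<le> n"
      using next_in_props[OF assms False] V(1) by auto
  qed auto
qed

lemma arc_order_eq:
  assumes "v \<in> V" "W \<subseteq> arc_set n V v" "W \<noteq> {}"
  shows "arc_order n V W = filter (\<lambda>k. k \<in> W) (arc n V v)"
proof -
  have "(THE v. v \<in> V \<and> W \<subseteq> set (arc n V v)) = v"
  proof (rule the_equality)
    fix v' assume "v' \<in> V \<and> W \<subseteq> set (arc n V v')"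
    then show "v' = v"
      using assms disjoint_arc_sets[of v v'] set_arc by blast
  qed (use assms set_arc in auto)
  then show ?thesis by (simp add: arc_order_def)
qed

end

text \<open>The assumption on \<open>g\<close> says that \<open>g\<close> is increasing up to a rotation which moves the elements
  below \<open>t\<close> behind the others.\<close>

lemma noncrossing_image:
  assumes "noncrossing \<pi>" "\<And>W. W \<in> \<pi> \<Longrightarrow> W \<subseteq> S"
    and g: "\<And>x y. x \<in> S \<Longrightarrow> y \<in> S \<Longrightarrow> g x < g y \<longleftrightarrow> (if x < t then x < y \<and> y < t else x < y \<or> y < t)"
  shows "noncrossing ((`) g ` \<pi>)"
  unfolding noncrossing_def
proof (intro ballI allI impI)
  fix X Y a b c d
  assume X: "X \<in> (`) g ` \<pi>" and Y: "Y \<in> (`) g ` \<pi>"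
    and *: "a < b \<and> b < c \<and> c < d \<and> a \<in> X \<and> c \<in> X \<and> b \<in> Y \<and> d \<in> Y"
  obtain V W where VW: "V \<in> \<pi>" "X = g ` V" "W \<in> \<pi>" "Y = g ` W" using X Y by blast
  obtain a' b' c' d' where e: "a' \<in> V" "a = g a'" "c' \<in> V" "c = g c'" "b' \<in> W" "b = g b'"
    "d' \<in> W" "d = g d'" using * VW by blast
  have "a' \<in> S" "c' \<in> S" "b' \<in> S" "d' \<in> S" using e VW assms(2) by blast+
  with g * e have "if a' < t then a' < b' \<and> b' < t else a' < b' \<or> b' < t"
    "if b' < t then b' < c' \<and> c' < t else b' < c' \<or> c' < t"
    "if c' < t then c' < d' \<and> d' < t else c' < d' \<or> d' < t"
    by blast+
  \<comment> \<open>The preimages are in one of the four cyclic rotations of the order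
    \<open>a'\<close>, \<open>b'\<close>, \<open>c'\<close>, \<open>d'\<close>, and each rotation is
    again a crossing.\<close>
  then consider "a' < b'" "b' < c'" "c' < d'" | "b' < c'" "c' < d'" "d' < a'"
    | "c' < d'" "d' < a'" "a' < b'" | "d' < a'" "a' < b'" "b' < c'"
    by (cases "a' < t"; cases "b' < t"; cases "c' < t"; cases "d' < t") auto
  then have "V = W"
  proof cases
    case 1 from noncrossingD[OF assms(1) VW(1,3) 1] e show ?thesis by simp
  next
    case 2 from noncrossingD[OF assms(1) VW(3,1) 2] e show ?thesis by simp
  next
    case 3 from noncrossingD[OF assms(1) VW(1,3) 3] e show ?thesis by simp
  next
    case 4 from noncrossingD[OF assms(1) VW(3,1) 4] e show ?thesis by simp
  qed
  then show "X = Y" using VW by simp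
qed

lemma filter_in_nth_image:
  assumes "distinct xs" "W \<subseteq> {..<length xs}"
  shows "filter (\<lambda>i. i \<in> (!) xs ` W) xs = nths xs W"
proof -
  have "{i. i < length xs \<and> xs ! i \<in> (!) xs ` W} = W"
    using assms by (auto simp: nth_eq_iff_index_eq subset_iff)
  then show ?thesis by (simp add: filter_eq_nths)
qed

text \<open>Positions on the arc are relabelled by their index in \<open>xs\<close>. This is
  increasing up to a rotation, so it preserves non-crossing partitions.\<close>

lemma sum_NC_on_arc:
  fixes \<phi> :: "nat list \<Rightarrow> complex"
  assumes xs: "xs = [a..<b] @ [0..<k]" and k: "k \<le> a"
  shows "(\<Sum>\<sigma>\<in>NC_on (set xs). \<Prod>W\<in>\<sigma>. \<phi> (filter (\<lambda>i. i \<in> W) xs)) =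
    (\<Sum>\<pi>\<in>NC (length xs). \<Prod>W\<in>\<pi>. \<phi> (nths xs W))"
proof -
  let ?m = "length xs"
  \<comment> \<open>The inverse of indexing into \<open>xs\<close>: positions below \<open>a\<close>
    come from the wrapped segment, which stands behind the first \<open>b - a\<close>
    entries.\<close>
  define e' where "e' j = (if j < a then j + (b - a) else j - a)" for j
  have e: "xs ! i = (if i < b - a then a + i else i - (b - a))" if "i < ?m" for i
    using that by (auto simp: xs nth_append)
  have dist: "distinct xs" using k by (auto simp: xs)
  have e'e: "e' (xs ! i) = i" if "i < ?m" for i
    using that k by (auto simp: e e'_def) (auto simp: xs)
  have e'_less: "e' j < ?m" and ee': "xs ! e' j = j" if "j \<in> set xs" for j
    using that k by (auto simp: e'_def xs nth_append)
  have im: "(!) xs ` {..<?m} = set xs"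
    by (auto simp: in_set_conv_nth)
  have im': "e' ` set xs = {..<?m}"
  proof
    show "e' ` set xs \<subseteq> {..<?m}" using e'_less by auto
    show "{..<?m} \<subseteq> e' ` set xs"
    proof
      fix i assume "i \<in> {..<?m}"
      then have "e' (xs ! i) = i" "xs ! i \<in> set xs" using e'e by auto
      then show "i \<in> e' ` set xs" by (metis imageI)
    qed
  qed
  have part: "partition_on (g ` S) ((`) g ` \<pi>)" if "partition_on S \<pi>" "inj_on g S" for g \<pi> and S :: "nat set"
  proof -
    have "(`) g ` \<pi> - {{}} = (`) g ` \<pi>" using partition_onD3[OF that(1)] by auto
    then show ?thesis using partition_on_inj_image[OF that] by simp
  qed
  show ?thesis
  proof (rule sum.reindex_bij_witness[where i = "\<lambda>\<pi>. (`) ((!) xs) ` \<pi>" and j = "\<lambda>\<sigma>. (`) e' ` \<sigma>"])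
    fix \<sigma> assume \<sigma>: "\<sigma> \<in> NC_on (set xs)"
    then have sub: "W \<subseteq> set xs" if "W \<in> \<sigma>" for W
      using that by (auto simp: NC_on_def partition_on_def)
    have img: "(!) xs ` e' ` W = W" if "W \<in> \<sigma>" for W
      using sub[OF that] ee' by (simp add: image_image subset_iff)
    then show "(`) ((!) xs) ` (`) e' ` \<sigma> = \<sigma>"
      by (simp add: image_image)
    have "noncrossing ((`) e' ` \<sigma>)"
    proof (rule noncrossing_image)
      show "noncrossing \<sigma>" using \<sigma> by (simp add: NC_on_def)
    next
      fix x y assume "x \<in> set xs" "y \<in> set xs"
      then show "e' x < e' y \<longleftrightarrow> (if x < a then x < y \<and> y < a else x < y \<or> y < a)"
        using k by (auto simp: e'_def xs)
    qed (rule sub)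
    moreover have "inj_on e' (set xs)" using ee' by (metis inj_on_inverseI)
    ultimately show j: "(`) e' ` \<sigma> \<in> NC ?m"
      using part[of "set xs" \<sigma> e'] \<sigma> by (simp add: NC_def NC_on_def im')
    have inj: "inj_on ((`) e') \<sigma>" using img by (metis inj_on_inverseI)
    have "\<phi> (nths xs (e' ` W)) = \<phi> (filter (\<lambda>i. i \<in> W) xs)" if "W \<in> \<sigma>" for W
    proof -
      have "e' ` W \<subseteq> {..<?m}" using sub[OF that] im' by blast
      from filter_in_nth_image[OF dist this] img[OF that] show ?thesis by simp
    qed
    then show "(\<Prod>W\<in>(`) e' ` \<sigma>. \<phi> (nths xs W)) = (\<Prod>W\<in>\<sigma>. \<phi> (filter (\<lambda>i. i \<in> W) xs))"
      by (simp add: prod.reindex[OF inj])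
  next
    fix \<pi> assume \<pi>: "\<pi> \<in> NC ?m"
    then have sub: "W \<subseteq> {..<?m}" if "W \<in> \<pi>" for W
      using that by (auto simp: NC_def partition_on_def)
    have "e' ` (!) xs ` W = W" if "W \<in> \<pi>" for W
      using sub[OF that] e'e by (simp add: image_image subset_iff)
    then show "(`) e' ` (`) ((!) xs) ` \<pi> = \<pi>"
      by (simp add: image_image)
    have "noncrossing ((`) ((!) xs) ` \<pi>)"
    proof (rule noncrossing_image)
      show "noncrossing \<pi>" using \<pi> by (simp add: NC_def)
    next
      fix x y assume "x \<in> {..<?m}" "y \<in> {..<?m}"
      then show "xs ! x < xs ! y \<longleftrightarrow> (if x < b - a then x < y \<and> y < b - a else x < y \<or> y < b - a)"
        using k by (auto simp: e) (auto simp: xs)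
    qed (rule sub)
    moreover have "inj_on ((!) xs) {..<?m}" using e'e by (metis inj_on_inverseI lessThan_iff)
    ultimately show "(`) ((!) xs) ` \<pi> \<in> NC_on (set xs)"
      using part[of "{..<?m}" \<pi> "(!) xs"] \<pi> by (simp add: NC_def NC_on_def im)
  qed
qed

lemma filter_in_upt_full:
  assumes "W \<subseteq> {a..<b}" "a \<le> b" "b \<le> n"
  shows "filter (\<lambda>i. i \<in> W) [0..<n] = filter (\<lambda>i. i \<in> W) [a..<b]"
proof -
  have "[0..<n] = [0..<a] @ [a..<b] @ [b..<n]"
    using assms upt_add_eq_append[of 0 a "n - a"] upt_add_eq_append[of a b "n - b"] by simp
  moreover have "filter (\<lambda>i. i \<in> W) [0..<a] = []" "filter (\<lambda>i. i \<in> W) [b..<n] = []"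
    using assms by (auto simp: filter_empty_conv)
  ultimately show ?thesis by simp
qed

lemma nths_eq_map_filter: "nths as W = map ((!) as) (filter (\<lambda>i. i \<in> W) [0..<length as])"
proof (induction as rule: rev_induct)
  case (snoc x as)
  have "map ((!) (as @ [x])) (filter (\<lambda>i. i \<in> W) [0..<length as]) =
      map ((!) as) (filter (\<lambda>i. i \<in> W) [0..<length as])"
    by (rule map_cong) (auto simp: nth_append)
  then show ?case by (simp add: snoc nths_append)
qed simp

section \<open>Moment formulas grouped by one block\<close>

locale noncrossing_moment =
  fixes M \<kappa> :: "'a list \<Rightarrow> complex"
  assumes M_eq: "M as = (\<Sum>\<pi>\<in>NC (length as). \<Prod>V\<in>\<pi>. \<kappa> (nths as V))"
begin

text \<open>On each arc, the sum over its non-crossing partitions is the moment formula for the word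
  read along that arc.\<close>

lemma sum_NC_containing_block_moment:
  assumes V: "V \<subseteq> {..<length as}" "V \<noteq> {}"
  shows "(\<Sum>\<pi> | \<pi> \<in> NC (length as) \<and> V \<in> \<pi>.
      \<Prod>W\<in>\<pi> - {V}. \<kappa> (map ((!) as) (arc_order (length as) V W))) =
    (\<Prod>v\<in>V. M (map ((!) as) (arc (length as) V v)))"
proof -
  let ?n = "length as"
  have "(\<Sum>\<sigma>\<in>NC_on (arc_set ?n V v). \<Prod>W\<in>\<sigma>. \<kappa> (map ((!) as) (arc_order ?n V W))) =
      M (map ((!) as) (arc ?n V v))" if v: "v \<in> V" for v
  proof -
    obtain a b k where xs: "arc ?n V v = [a..<b] @ [0..<k]" "k \<le> a"
      using arc_form[OF V v] by metis
    have "arc_order ?n V W = filter (\<lambda>k. k \<in> W) (arc ?n V v)"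
      if "\<sigma> \<in> NC_on (arc_set ?n V v)" "W \<in> \<sigma>" for \<sigma> W
      using that by (intro arc_order_eq[OF V v]) (auto simp: NC_on_def partition_on_def)
    then have "(\<Sum>\<sigma>\<in>NC_on (arc_set ?n V v). \<Prod>W\<in>\<sigma>. \<kappa> (map ((!) as) (arc_order ?n V W))) =
      (\<Sum>\<sigma>\<in>NC_on (set (arc ?n V v)). \<Prod>W\<in>\<sigma>. \<kappa> (map ((!) as) (filter (\<lambda>k. k \<in> W) (arc ?n V v))))"
      using set_arc[OF V v] by (intro sum.cong prod.cong) auto
    also have "\<dots> = (\<Sum>\<pi>\<in>NC (length (arc ?n V v)). \<Prod>W\<in>\<pi>. \<kappa> (map ((!) as) (nths (arc ?n V v) W)))"
      using sum_NC_on_arc[OF xs, of "\<lambda>l. \<kappa> (map ((!) as) l)"] .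
    also have "\<dots> = M (map ((!) as) (arc ?n V v))"
      by (simp add: M_eq nths_map)
    finally show ?thesis .
  qed
  then show ?thesis
    using sum_NC_containing_block[OF V] by simp
qed

text \<open>No arc passes 0 when 0 is in \<open>V\<close>, so clockwise order is increasing order.
  Thus the arc expansion also serves the free moment formula.\<close>

lemma arc_order_nths:
  assumes \<pi>: "\<pi> \<in> NC (length as)" "V \<in> \<pi>" "W \<in> \<pi>" "W \<noteq> V" and "0 \<in> V"
  shows "map ((!) as) (arc_order (length as) V W) = nths as W"
proof -
  have V: "V \<subseteq> {..<length as}" "V \<noteq> {}" and W: "W \<noteq> {}"
    using \<pi> by (auto simp: NC_def partition_on_def)
  obtain v where v: "v \<in> V" "W \<subseteq> arc_set (length as) V v"
    using block_in_arc_set[OF V \<pi>] by blast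
  obtain a b where xs: "arc (length as) V v = [a..<b]" "a \<le> b" "b \<le> length as"
    using arc_form[OF V v(1)] \<open>0 \<in> V\<close> by (metis append_Nil2 upt_0)
  then have "W \<subseteq> {a..<b}" using v set_arc[OF V v(1)] by simp
  then show ?thesis
    using arc_order_eq[OF V v W] xs by (simp add: nths_eq_map_filter filter_in_upt_full)
qed

text \<open>Every partition has exactly one block containing position 0, and the sum is sorted by
  this block.\<close>

lemma moment_sum_first_block:
  assumes "as \<noteq> []"
  shows "M as = (\<Sum>V | V \<subseteq> {..<length as} \<and> 0 \<in> V.
    \<kappa> (nths as V) * (\<Prod>v\<in>V. M (map ((!) as) (arc (length as) V v))))"
proof -
  let ?n = "length as"
  let ?B = "{V. V \<subseteq> {..<?n} \<and> 0 \<in> V}"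
  have fin: "finite ?B" by (rule finite_subset[of _ "Pow {..<?n}"]) auto
  have "(\<Prod>V\<in>\<pi>. \<kappa> (nths as V)) = (\<Sum>V\<in>{V \<in> ?B. V \<in> \<pi>}. \<kappa> (nths as V) * (\<Prod>W\<in>\<pi> - {V}. \<kappa> (nths as W)))"
    if \<pi>: "\<pi> \<in> NC ?n" for \<pi>
  proof -
    have p: "\<Union>\<pi> = {..<?n}" "disjoint \<pi>" using \<pi> by (auto simp: NC_def partition_on_def)
    then have "0 \<in> \<Union>\<pi>" using assms by simp
    then obtain V where V: "V \<in> \<pi>" "0 \<in> V" by blast
    have "{V \<in> ?B. V \<in> \<pi>} = {V}" using V p by (auto simp: disjoint_def)
    moreover have "finite \<pi>" using p(1) by (intro finite_UnionD) simp
    ultimately show ?thesis using V by (simp add: prod.remove)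
  qed
  then have "M as = (\<Sum>\<pi>\<in>NC ?n. \<Sum>V\<in>{V \<in> ?B. V \<in> \<pi>}. \<kappa> (nths as V) * (\<Prod>W\<in>\<pi> - {V}. \<kappa> (nths as W)))"
    by (simp add: M_eq)
  also have "\<dots> = (\<Sum>V\<in>?B. \<Sum>\<pi> | \<pi> \<in> NC ?n \<and> V \<in> \<pi>. \<kappa> (nths as V) * (\<Prod>W\<in>\<pi> - {V}. \<kappa> (nths as W)))"
    by (rule sum.swap_restrict[OF finite_NC fin])
  also have "\<dots> = (\<Sum>V\<in>?B. \<kappa> (nths as V) * (\<Prod>v\<in>V. M (map ((!) as) (arc ?n V v))))"
  proof (rule sum.cong[OF refl])
    fix V assume V: "V \<in> ?B"
    have "(\<Sum>\<pi> | \<pi> \<in> NC ?n \<and> V \<in> \<pi>. \<Prod>W\<in>\<pi> - {V}. \<kappa> (nths as W)) =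
        (\<Sum>\<pi> | \<pi> \<in> NC ?n \<and> V \<in> \<pi>. \<Prod>W\<in>\<pi> - {V}. \<kappa> (map ((!) as) (arc_order ?n V W)))"
    proof (intro sum.cong prod.cong refl)
      fix \<pi> W assume "\<pi> \<in> {\<pi>. \<pi> \<in> NC ?n \<and> V \<in> \<pi>}" "W \<in> \<pi> - {V}"
      then show "\<kappa> (nths as W) = \<kappa> (map ((!) as) (arc_order ?n V W))"
        using V by (subst arc_order_nths) auto
    qed
    moreover have "V \<noteq> {}" using V by auto
    ultimately show "(\<Sum>\<pi> | \<pi> \<in> NC ?n \<and> V \<in> \<pi>. \<kappa> (nths as V) * (\<Prod>W\<in>\<pi> - {V}. \<kappa> (nths as W))) =
        \<kappa> (nths as V) * (\<Prod>v\<in>V. M (map ((!) as) (arc ?n V v)))"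
      using V sum_NC_containing_block_moment[of V as] by (simp flip: sum_distrib_left)
  qed
  finally show ?thesis .
qed

lemma bracket_sum:
  "(\<Sum>\<pi>\<in>NC (length as). bracket \<kappa> Df \<pi> as) = (\<Sum>V | V \<subseteq> {..<length as} \<and> V \<noteq> {}.
    Df (nths as V) * (\<Prod>v\<in>V. M (map ((!) as) (arc (length as) V v))))"
proof -
  let ?n = "length as"
  let ?B = "{V. V \<subseteq> {..<?n} \<and> V \<noteq> {}}"
  let ?f = "\<lambda>\<pi> V. Df (nths as V) * (\<Prod>W\<in>\<pi> - {V}. \<kappa> (map ((!) as) (arc_order ?n V W)))"
  have fin: "finite ?B" by (rule finite_subset[of _ "Pow {..<?n}"]) auto
  have "bracket \<kappa> Df \<pi> as = (\<Sum>V\<in>{V \<in> ?B. V \<in> \<pi>}. ?f \<pi> V)" if "\<pi> \<in> NC ?n" for \<pi>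
    unfolding bracket_def
    using that by (intro sum.cong refl) (auto simp: NC_def partition_on_def)
  then have "(\<Sum>\<pi>\<in>NC ?n. bracket \<kappa> Df \<pi> as) = (\<Sum>\<pi>\<in>NC ?n. \<Sum>V\<in>{V \<in> ?B. V \<in> \<pi>}. ?f \<pi> V)"
    by (rule sum.cong[OF refl])
  also have "\<dots> = (\<Sum>V\<in>?B. \<Sum>\<pi> | \<pi> \<in> NC ?n \<and> V \<in> \<pi>. ?f \<pi> V)"
    by (rule sum.swap_restrict[OF finite_NC fin])
  also have "\<dots> = (\<Sum>V\<in>?B. Df (nths as V) * (\<Prod>v\<in>V. M (map ((!) as) (arc ?n V v))))"
    by (intro sum.cong refl) (simp add: sum_NC_containing_block_moment flip: sum_distrib_left)
  finally show ?thesis .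
qed

end

section \<open>Sums over blocks as gap sums\<close>

lemma subsets_snoc:
  "{V. V \<subseteq> {..<Suc n} \<and> 0 \<in> V} = (if n = 0 then {{0}} else
    {V. V \<subseteq> {..<n} \<and> 0 \<in> V} \<union> insert n ` {V. V \<subseteq> {..<n} \<and> (0::nat) \<in> V})"
proof (cases "n = 0")
  case False
  have "V \<in> {V. V \<subseteq> {..<n} \<and> 0 \<in> V} \<union> insert n ` {V. V \<subseteq> {..<n} \<and> 0 \<in> V}"
    if V: "V \<subseteq> {..<Suc n}" "0 \<in> V" for V
  proof (cases "n \<in> V")
    case True
    then have "V = insert n (V - {n})" "V - {n} \<subseteq> {..<n}" "0 \<in> V - {n}"
      using V False by (auto simp: less_Suc_eq)
    then show ?thesis by blast
  next
    case False
    then show ?thesis using V by (auto simp: less_Suc_eq)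
  qed
  then show ?thesis using False by auto
qed auto

text \<open>Passes from the recursive choice of letters to the set \<open>V\<close> of chosen
  positions. The induction is from the right, because a new last letter only affects the last gap,
  the second argument of \<open>F\<close>.\<close>

lemma gap_sum_eq_sum:
  assumes "as = x # w"
  shows "gap_sum M (\<lambda>v. F (x # v)) [] w = (\<Sum>V | V \<subseteq> {..<length as} \<and> 0 \<in> V.
    F (nths as V) (map ((!) as) [Suc (Max V)..<length as]) *
    (\<Prod>v\<in>V - {Max V}. M (map ((!) as) [Suc v..<next_in V v])))"
  using assms
proof (induction w arbitrary: as F rule: rev_induct)
  case Nil
  then show ?case by (simp add: subsets_snoc)
next
  case (snoc y w)
  define bs where "bs = x # w"
  define n where "n = length bs"
  have as: "as = bs @ [y]" and n0: "n \<noteq> 0" using snoc.prems by (auto simp: bs_def n_def)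
  let ?B = "{V. V \<subseteq> {..<n} \<and> 0 \<in> V}"
  define P where "P V = (\<Prod>v\<in>V - {Max V}. M (map ((!) bs) [Suc v..<next_in V v]))" for V
  define L where "L V = map ((!) bs) [Suc (Max V)..<n]" for V
  let ?t = "\<lambda>V. F (nths as V) (map ((!) as) [Suc (Max V)..<length as]) *
    (\<Prod>v\<in>V - {Max V}. M (map ((!) as) [Suc v..<next_in V v]))"
  have fin: "finite ?B" by (rule finite_subset[of _ "Pow {..<n}"]) auto
  have ms: "map ((!) as) [a..<b] = map ((!) bs) [a..<b]" if "b \<le> n" for a b
    using that by (auto simp: as nth_append n_def)
  have facts: "Max V < n" "Max V \<in> V" "finite V" "n \<notin> V" "V \<noteq> {}"
    "\<And>v. v \<in> V \<Longrightarrow> v \<noteq> Max V \<Longrightarrow> next_in V v < n" if V: "V \<in> ?B" for V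
  proof -
    have V': "V \<subseteq> {..<n}" "V \<noteq> {}" using V by auto
    show "Max V < n" "Max V \<in> V" "finite V" "n \<notin> V" "V \<noteq> {}"
      using Max_block[OF V'] finite_block[OF V'] V' by auto
    show "next_in V v < n" if "v \<in> V" "v \<noteq> Max V" for v
      using next_in_props(1)[OF V' that] V' by auto
  qed
  \<comment> \<open>Unchosen, \<open>y\<close> lengthens the last gap.\<close>
  have t1: "?t V = F (nths bs V) (L V @ [y]) * P V" if V: "V \<in> ?B" for V
  proof -
    have "nths as V = nths bs V" using V by (auto simp: as nths_append n_def)
    moreover have "map ((!) as) [Suc (Max V)..<length as] = L V @ [y]"
      using facts(1)[OF V] ms[of n] by (simp add: L_def as n_def[symmetric]) (simp add: n_def)
    moreover have "(\<Prod>v\<in>V - {Max V}. M (map ((!) as) [Suc v..<next_in V v])) = P V"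
      unfolding P_def
    proof (rule prod.cong[OF refl])
      fix v assume "v \<in> V - {Max V}"
      then have "next_in V v \<le> n" using facts(6)[OF V, of v] by simp
      then show "M (map ((!) as) [Suc v..<next_in V v]) = M (map ((!) bs) [Suc v..<next_in V v])"
        by (simp only: ms)
    qed
    ultimately show ?thesis by simp
  qed
  \<comment> \<open>Chosen, \<open>y\<close> closes the gap \<open>L V\<close>, which turns into an
    inner factor, and leaves an empty last gap.\<close>
  have t2: "?t (insert n V) = M (L V) * F (nths bs V @ [y]) [] * P V" if V: "V \<in> ?B" for V
  proof -
    note f = facts[OF V]
    have Max: "Max (insert n V) = n" using f V
      by (subst Max_insert[OF f(3,5)]) (rule max.absorb3[OF f(1)])
    have "nths as (insert n V) = nths bs (insert n V) @ [y]"
      by (simp add: as nths_append n_def)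
    also have "nths bs (insert n V) = nths bs V"
      unfolding nths_eq_map_filter by (rule arg_cong[where f = "map _"], rule filter_cong) (auto simp: n_def)
    finally have nths: "nths as (insert n V) = nths bs V @ [y]" .
    have last: "map ((!) as) [Suc (Max (insert n V))..<length as] = []"
      unfolding Max by (simp add: as n_def)
    have nx: "next_in (insert n V) v = (if v = Max V then n else next_in V v)" if v: "v \<in> V" for v
    proof (cases "v = Max V")
      case True
      have "\<not> v < u" if "u \<in> V" for u using Max_ge[OF f(3) that] True by simp
      moreover have "v < n" using True f(1) by simp
      ultimately have "{u \<in> insert n V. v < u} = {n}" by auto
      then have "next_in (insert n V) v = n" by (simp add: next_in_def)
      then show ?thesis by (simp only: True if_True simp_thms)
    next
      case False
      have "v < Max V" using False v f(3) by (simp add: order_less_le)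
      then have ne: "{u \<in> V. v < u} \<noteq> {}" using f(2) by auto
      have "v < n" using v V by auto
      then have "{u \<in> insert n V. v < u} = insert n {u \<in> V. v < u}" by auto
      then have "next_in (insert n V) v = min n (next_in V v)"
        unfolding next_in_def using Min_insert[OF _ ne, of n] f(3) by simp
      also have "\<dots> = next_in V v" using f(6)[OF v False] by simp
      finally show ?thesis using False by simp
    qed
    have "(\<Prod>v\<in>insert n V - {n}. M (map ((!) as) [Suc v..<next_in (insert n V) v])) =
        (\<Prod>v\<in>V. M (map ((!) bs) [Suc v..<if v = Max V then n else next_in V v]))"
    proof (rule prod.cong)
      fix v assume v: "v \<in> V"
      have "(if v = Max V then n else next_in V v) \<le> n" using f(6)[OF v] by auto
      then show "M (map ((!) as) [Suc v..<next_in (insert n V) v]) =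
          M (map ((!) bs) [Suc v..<if v = Max V then n else next_in V v])"
        by (simp only: nx[OF v] ms)
    qed (use f(4) in simp)
    also have "\<dots> = M (L V) * P V"
    proof -
      have "(\<Prod>v\<in>V - {Max V}. M (map ((!) bs) [Suc v..<if v = Max V then n else next_in V v])) = P V"
        unfolding P_def by (intro prod.cong) auto
      then show ?thesis by (simp add: prod.remove[OF f(3,2)] L_def)
    qed
    finally have "(\<Prod>v\<in>insert n V - {Max (insert n V)}. M (map ((!) as) [Suc v..<next_in (insert n V) v]))
      = M (L V) * P V" unfolding Max .
    then show ?thesis unfolding nths last by simp
  qed
  have inj: "inj_on (insert n) ?B"
    by (rule inj_onI) (metis facts(4) insert_ident)
  have "{V. V \<subseteq> {..<length as} \<and> 0 \<in> V} = ?B \<union> insert n ` ?B"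
    using n0 subsets_snoc[of n] by (simp add: as flip: n_def)
  then have "(\<Sum>V | V \<subseteq> {..<length as} \<and> 0 \<in> V. ?t V) = (\<Sum>V\<in>?B \<union> insert n ` ?B. ?t V)"
    by (simp only:)
  also have "\<dots> = (\<Sum>V\<in>?B. ?t V) + (\<Sum>V\<in>insert n ` ?B. ?t V)"
    using fin by (intro sum.union_disjoint) auto
  also have "\<dots> = (\<Sum>V\<in>?B. ?t V) + (\<Sum>V\<in>?B. ?t (insert n V))"
    by (simp only: sum.reindex[OF inj] o_def)
  also have "\<dots> = (\<Sum>V\<in>?B. F (nths bs V) (L V @ [y]) * P V)
      + (\<Sum>V\<in>?B. M (L V) * F (nths bs V @ [y]) [] * P V)"
    by (intro arg_cong2[where f = "(+)"] sum.cong refl) (erule t1, erule t2)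
  also have "\<dots> = (\<Sum>V\<in>?B. (F (nths bs V) (L V @ [y]) + M (L V) * F (nths bs V @ [y]) []) * P V)"
    by (simp add: sum.distrib distrib_right)
  also have "\<dots> = gap_sum M (\<lambda>v h. F (x # v) (h @ [y]) + M h * F (x # v @ [y]) []) [] w"
    using snoc.IH[OF bs_def, of "\<lambda>v h. F v (h @ [y]) + M h * F (v @ [y]) []"]
    by (simp add: L_def P_def n_def)
  also have "\<dots> = gap_sum M (\<lambda>v. F (x # v)) [] (w @ [y])"
    by (simp add: gap_sum_append)
  finally show ?case by (rule sym)
qed

lemma prod_arcs:
  assumes V: "V \<subseteq> {..<n}" "V \<noteq> {}"
  shows "(\<Prod>v\<in>V. M (map f (arc n V v))) = (M (map f ([Suc (Max V)..<n] @ [0..<Min V])) :: complex) *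
    (\<Prod>v\<in>V - {Max V}. M (map f [Suc v..<next_in V v]))"
proof -
  have "(\<Prod>v\<in>V - {Max V}. M (map f (arc n V v))) = (\<Prod>v\<in>V - {Max V}. M (map f [Suc v..<next_in V v]))"
    by (intro prod.cong refl) (simp add: arc_not_Max[OF V])
  then show ?thesis
    by (simp add: prod.remove[OF finite_block[OF V] Max_block(1)[OF V]] arc_Max[OF V])
qed

lemma avoiding_sum_eq_sum:
  "avoiding_sum M D p w = (\<Sum>i<length w.
    gap_sum M (\<lambda>v h. D (w ! i # v) * M (h @ p @ take i w)) [] (drop (Suc i) w))"
  by (induction w arbitrary: p) (simp_all add: sum.lessThan_Suc_shift del: sum.lessThan_Suc)

lemma map_upt_drop:
  "k + b \<le> length as \<Longrightarrow> map ((!) as) [k + a..<k + b] = map ((!) (drop k as)) [a..<b]"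
  by (rule nth_equalityI) (auto simp: add.assoc)

lemma shift_block:
  assumes V: "V \<noteq> {}" "finite V"
  shows "Max ((+) k ` V) = k + Max V" "Min ((+) k ` V) = k + Min V"
    "v \<in> V \<Longrightarrow> v \<noteq> Max V \<Longrightarrow> next_in ((+) k ` V) (k + v) = k + next_in V v"
proof -
  have mono: "mono ((+) k)" by (simp add: monoI)
  show "Max ((+) k ` V) = k + Max V" "Min ((+) k ` V) = k + Min V"
    using mono_Max_commute[OF mono] mono_Min_commute[OF mono] V by auto
  assume v: "v \<in> V" "v \<noteq> Max V"
  then have "v < Max V" using V by (simp add: order_less_le)
  then have "{u \<in> V. v < u} \<noteq> {}" using Max_in[OF V(2,1)] by auto
  moreover have "{u \<in> (+) k ` V. k + v < u} = (+) k ` {u \<in> V. v < u}" by auto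
  ultimately show "next_in ((+) k ` V) (k + v) = k + next_in V v"
    unfolding next_in_def using mono_Min_commute[OF mono, of "{u \<in> V. v < u}"] V by simp
qed

text \<open>Blocks are grouped by their minimum \<open>k\<close> and shifted down so that they
  contain 0. The \<open>k\<close> letters before the minimum complete the arc after the
  maximum.\<close>

lemma sum_blocks_eq_avoiding_sum:
  "(\<Sum>V | V \<subseteq> {..<length as} \<and> V \<noteq> {}. D (nths as V) *
    (\<Prod>v\<in>V. M (map ((!) as) (arc (length as) V v)))) = avoiding_sum M D [] as"
proof -
  let ?n = "length as"
  let ?B = "{V. V \<subseteq> {..<?n} \<and> V \<noteq> {}}"
  let ?g = "\<lambda>V. D (nths as V) * (\<Prod>v\<in>V. M (map ((!) as) (arc ?n V v)))"
  have fin: "finite ?B" by (rule finite_subset[of _ "Pow {..<?n}"]) auto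
  have "(\<Sum>V | V \<in> ?B \<and> Min V = k. ?g V) =
      gap_sum M (\<lambda>v h. D (as ! k # v) * M (h @ [] @ take k as)) [] (drop (Suc k) as)" if k: "k < ?n" for k
  proof -
    define bs where "bs = drop k as"
    let ?m = "length bs"
    let ?B' = "{V. V \<subseteq> {..<?m} \<and> 0 \<in> V}"
    have n: "?n = k + ?m" using k by (simp add: bs_def)
    have bs: "bs = as ! k # drop (Suc k) as" using k by (simp add: bs_def Cons_nth_drop_Suc)
    have inj: "inj_on ((`) ((+) k)) ?B'" by (simp add: inj_on_def inj_image_eq_iff)
    have "{V. V \<in> ?B \<and> Min V = k} = (`) ((+) k) ` ?B'"
    proof (intro equalityI subsetI)
      fix V assume "V \<in> {V. V \<in> ?B \<and> Min V = k}"
      then have V: "V \<subseteq> {..<?n}" "V \<noteq> {}" "Min V = k" by auto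
      have "finite V" using V(1) finite_subset by blast
      then have ge: "k \<le> u" if "u \<in> V" for u using V that Min_le by blast
      have "k \<in> V" using Min_in[OF \<open>finite V\<close> V(2)] V(3) by simp
      define U where "U = (\<lambda>u. u - k) ` V"
      have "(+) k ` U = V" using ge by (force simp: U_def image_image)
      moreover have "U \<in> ?B'"
        using V(1) ge \<open>k \<in> V\<close> n by (force simp: U_def subset_iff)
      ultimately show "V \<in> (`) ((+) k) ` ?B'" by blast
    next
      fix V assume "V \<in> (`) ((+) k) ` ?B'"
      then obtain U where U: "V = (+) k ` U" "U \<subseteq> {..<?m}" "0 \<in> U" by blast
      have "finite U" using U(2) finite_subset by blast
      then have "Min U = 0" using U(3) Min_le by blast
      then have "Min V = k" using shift_block(2)[of U k] U \<open>finite U\<close> by auto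
      moreover have "V \<subseteq> {..<?n}" using U n by auto
      ultimately show "V \<in> {V. V \<in> ?B \<and> Min V = k}" using U by auto
    qed
    then have "(\<Sum>V | V \<in> ?B \<and> Min V = k. ?g V) = (\<Sum>U\<in>?B'. ?g ((+) k ` U))"
      by (simp only: sum.reindex[OF inj] o_def)
    also have "\<dots> = (\<Sum>U\<in>?B'. D (nths bs U) * M (map ((!) bs) [Suc (Max U)..<?m] @ [] @ take k as) *
        (\<Prod>v\<in>U - {Max U}. M (map ((!) bs) [Suc v..<next_in U v])))"
    proof (rule sum.cong[OF refl])
      fix U assume "U \<in> ?B'"
      then have U: "U \<subseteq> {..<?m}" "0 \<in> U" "U \<noteq> {}" by auto
      have finU: "finite U" using U(1) finite_subset by blast
      let ?V = "(+) k ` U"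
      have V: "?V \<subseteq> {..<?n}" "?V \<noteq> {}" using U n by auto
      note sh = shift_block[OF U(3) finU]
      have Min0: "Min U = 0" using U(2) finU Min_le by blast
      have "nths as ?V = nths bs U" by (simp add: bs_def nths_drop)
      moreover have "map ((!) as) ([Suc (Max ?V)..<?n] @ [0..<Min ?V]) =
          map ((!) bs) [Suc (Max U)..<?m] @ [] @ take k as"
      proof -
        have "map ((!) as) [k + Suc (Max U)..<k + ?m] = map ((!) bs) [Suc (Max U)..<?m]"
          unfolding bs_def by (rule map_upt_drop) (use n bs_def in simp)
        moreover have "map ((!) as) [0..<k] = take k as"
          using k by (simp add: list_eq_iff_nth_eq)
        ultimately show ?thesis by (simp add: sh Min0 n)
      qed
      moreover have "(\<Prod>v\<in>?V - {Max ?V}. M (map ((!) as) [Suc v..<next_in ?V v])) =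
          (\<Prod>v\<in>U - {Max U}. M (map ((!) bs) [Suc v..<next_in U v]))"
      proof -
        have "?V - {Max ?V} = (+) k ` (U - {Max U})" by (auto simp: sh(1))
        then have "(\<Prod>v\<in>?V - {Max ?V}. M (map ((!) as) [Suc v..<next_in ?V v])) =
            (\<Prod>v\<in>U - {Max U}. M (map ((!) as) [k + Suc v..<next_in ?V (k + v)]))"
          by (simp add: prod.reindex)
        also have "\<dots> = (\<Prod>v\<in>U - {Max U}. M (map ((!) bs) [Suc v..<next_in U v]))"
        proof (rule prod.cong[OF refl])
          fix v assume "v \<in> U - {Max U}"
          then have v: "v \<in> U" "v \<noteq> Max U" by auto
          have "next_in U v < ?m" using next_in_props(1)[OF U(1,3) v] U(1) by auto
          then have "k + next_in U v \<le> ?n" using n by simp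
          from map_upt_drop[OF this, of "Suc v"]
          show "M (map ((!) as) [k + Suc v..<next_in ?V (k + v)]) = M (map ((!) bs) [Suc v..<next_in U v])"
            unfolding sh(3)[OF v] bs_def by simp
        qed
        finally show ?thesis .
      qed
      ultimately show "?g ?V = D (nths bs U) * M (map ((!) bs) [Suc (Max U)..<?m] @ [] @ take k as) *
          (\<Prod>v\<in>U - {Max U}. M (map ((!) bs) [Suc v..<next_in U v]))"
        unfolding prod_arcs[OF V] by (simp only: mult.assoc)
    qed
    also have "\<dots> = gap_sum M (\<lambda>v h. D (as ! k # v) * M (h @ [] @ take k as)) [] (drop (Suc k) as)"
      using gap_sum_eq_sum[OF bs, of M "\<lambda>v h. D v * M (h @ [] @ take k as)"] by (rule sym)
    finally show ?thesis .
  qed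
  then have "(\<Sum>k<?n. \<Sum>V | V \<in> ?B \<and> Min V = k. ?g V) = avoiding_sum M D [] as"
    unfolding avoiding_sum_eq_sum by (intro sum.cong refl) simp
  moreover have "Min ` ?B \<subseteq> {..<?n}"
  proof
    fix k assume "k \<in> Min ` ?B"
    then obtain V where V: "V \<subseteq> {..<?n}" "V \<noteq> {}" "k = Min V" by blast
    then have "finite V" using finite_subset by blast
    then show "k \<in> {..<?n}" using Min_in V by blast
  qed
  ultimately show ?thesis
    using sum.group[OF fin finite_lessThan, of Min ?n ?g] by simp
qed

context noncrossing_moment
begin

lemma moment_Cons: "M (x # w) = gap_sum M (\<lambda>v h. \<kappa> (x # v) * M h) [] w"
proof -
  define as where "as = x # w"
  have "M as = (\<Sum>V | V \<subseteq> {..<length as} \<and> 0 \<in> V.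
      \<kappa> (nths as V) * M (map ((!) as) [Suc (Max V)..<length as]) *
      (\<Prod>v\<in>V - {Max V}. M (map ((!) as) [Suc v..<next_in V v])))"
  proof (subst moment_sum_first_block, simp add: as_def, rule sum.cong[OF refl])
    fix V assume "V \<in> {V. V \<subseteq> {..<length as} \<and> 0 \<in> V}"
    then have V: "V \<subseteq> {..<length as}" "V \<noteq> {}" and "0 \<in> V" by auto
    then have "Min V = 0" using Min_le[OF finite_block[OF V]] by blast
    then show "\<kappa> (nths as V) * (\<Prod>v\<in>V. M (map ((!) as) (arc (length as) V v))) =
        \<kappa> (nths as V) * M (map ((!) as) [Suc (Max V)..<length as]) *
        (\<Prod>v\<in>V - {Max V}. M (map ((!) as) [Suc v..<next_in V v]))"
      unfolding prod_arcs[OF V] by simp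
  qed
  also have "\<dots> = gap_sum M (\<lambda>v h. \<kappa> (x # v) * M h) [] w"
    by (rule gap_sum_eq_sum[OF as_def, of M "\<lambda>v h. \<kappa> v * M h", symmetric])
  finally show ?thesis by (simp add: as_def)
qed

lemma bracket_sum_eq_avoiding_sum:
  "(\<Sum>\<pi>\<in>NC (length as). bracket \<kappa> D \<pi> as) = avoiding_sum M D [] as"
  unfolding bracket_sum by (rule sum_blocks_eq_avoiding_sum)

end

section \<open>Cyclic freeness and vanishing of mixed cumulants\<close>

lemma not_distinct_adj_split: "\<not> distinct_adj js \<Longrightarrow> \<exists>us j vs. js = us @ j # j # vs"
proof (induction js)
  case (Cons j js)
  show ?case
  proof (cases "distinct_adj js")
    case True
    then obtain js' where "js = j # js'" using Cons.prems by (cases js) auto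
    then show ?thesis by (metis append_Nil)
  next
    case False
    then show ?thesis using Cons.IH by (metis append_Cons)
  qed
qed simp

lemma word_in_Cons: "word_in I A (j # js) (a # as) \<longleftrightarrow> j \<in> I \<and> a \<in> A j \<and> word_in I A js as"
  by (simp add: word_in_def)

lemma word_in_Nil: "word_in I A [] []"
  by (simp add: word_in_def)

lemma word_in_append: "word_in I A js as \<Longrightarrow> word_in I A js' as' \<Longrightarrow> word_in I A (js @ js') (as @ as')"
  by (simp add: word_in_def list_all2_appendI)

lemma word_in_take_drop:
  assumes "word_in I A js as"
  shows "word_in I A (take i js) (take i as)" "word_in I A (drop i js) (drop i as)"
  using assms by (simp_all add: word_in_def)

lemma word_in_append_left:
  assumes "word_in I A (us @ vs) as"
  obtains u v where "as = u @ v" "word_in I A us u" "word_in I A vs v"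
  using assms by (auto simp: word_in_def list_all2_append1)

lemma word_in_append_right:
  assumes "word_in I A js (u @ v)"
  obtains us vs where "js = us @ vs" "word_in I A us u" "word_in I A vs v"
  using assms by (auto simp: word_in_def list_all2_append2)

lemma word_in_length: "word_in I A js as \<Longrightarrow> length js = length as"
  by (simp add: word_in_def list_all2_lengthD)

lemma word_in_pair_split:
  assumes "word_in I A (us @ j # j # vs) as"
  obtains u a b w where "as = u @ a # b # w" "word_in I A us u" "word_in I A vs w"
    "j \<in> I" "a \<in> A j" "b \<in> A j"
proof -
  obtain u v where v: "as = u @ v" "word_in I A us u" "word_in I A (j # j # vs) v"
    using word_in_append_left[OF assms] .
  then obtain a b w where "v = a # b # w" "word_in I A vs w" "j \<in> I" "a \<in> A j" "b \<in> A j"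
    by (auto simp: word_in_def list_all2_Cons1)
  with v that show thesis by blast
qed

section \<open>Centering of entries\<close>

locale cyclic_freeness =
  fixes scale :: "complex \<Rightarrow> 'a::ring_1 \<Rightarrow> 'a"
    and \<psi> \<omega> :: "'a \<Rightarrow> complex" and I :: "'i set" and A :: "'i \<Rightarrow> 'a set"
  assumes algebra: "complex_algebra scale"
    and linear_\<psi>: "Vector_Spaces.linear scale (*) \<psi>" and \<psi>_one: "\<psi> 1 = 1"
    and linear_\<omega>: "Vector_Spaces.linear scale (*) \<omega>" and tracial: "tracial \<omega>" and \<omega>_one: "\<omega> 1 = 0"
    and subalgebra: "\<And>i. i \<in> I \<Longrightarrow> unital_subalgebra scale (A i)"
begin

abbreviation "M \<equiv> \<lambda>w. \<psi> (prod_list w)"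
abbreviation "N \<equiv> \<lambda>w. \<omega> (prod_list w)"
abbreviation "\<kappa> \<equiv> free_cumulant \<psi>"
abbreviation "D \<equiv> cyclic_free_cumulant \<psi> \<omega>"

sublocale noncrossing_moment M \<kappa>
proof
  fix as :: "'a list"
  show "\<psi> (prod_list as) = (\<Sum>\<pi>\<in>NC (length as). \<Prod>V\<in>\<pi>. \<kappa> (nths as V))"
  proof (cases "as = []")
    case True
    have "NC 0 = {{}}" by (auto simp: NC_def partition_on_empty noncrossing_def)
    then show ?thesis using True by (simp add: \<psi>_one)
  next
    case False
    then show ?thesis by (rule moment_free_cumulant)
  qed
qed

sublocale cyclic_moment_cumulant M \<kappa> N D
proof
  show "\<psi> (prod_list []) = 1" by (simp add: \<psi>_one)
  show "\<psi> (prod_list (x # w)) = gap_sum M (\<lambda>v h. \<kappa> (x # v) * \<psi> (prod_list h)) [] w" for x w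
    by (rule moment_Cons)
  show "\<omega> (prod_list w) = avoiding_sum M D [] w" for w
  proof (cases "w = []")
    case False
    then show ?thesis
      unfolding bracket_sum_eq_avoiding_sum[symmetric] by (rule moment_cyclic_free_cumulant)
  qed (simp add: \<omega>_one)
  show "\<omega> (prod_list (x # w)) = \<omega> (prod_list (w @ [x]))" for x w
    using tracial by (simp add: tracial_def)
qed

definition center :: "'a \<Rightarrow> 'a" where
  "center a = a - scale (\<psi> a) 1"

lemma \<psi>_center: "\<psi> (center a) = 0"
proof -
  interpret Vector_Spaces.linear scale "(*)" \<psi> by (rule linear_\<psi>)
  show ?thesis by (simp add: center_def diff scale \<psi>_one)
qed

lemma center_in: "i \<in> I \<Longrightarrow> a \<in> A i \<Longrightarrow> center a \<in> A i"
proof -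
  interpret complex_algebra scale by (rule algebra)
  show "i \<in> I \<Longrightarrow> a \<in> A i \<Longrightarrow> center a \<in> A i"
    using subalgebra[of i] by (auto simp: unital_subalgebra_def center_def intro: subspace_diff subspace_scale)
qed

lemma linear_center:
  assumes "Vector_Spaces.linear scale (*) f"
  shows "f (p * (center a * q)) = f (p * (a * q)) + - \<psi> a * f (p * q)"
proof -
  interpret complex_algebra scale by (rule algebra)
  interpret Vector_Spaces.linear scale "(*)" f by (rule assms)
  show ?thesis
    by (simp add: center_def left_diff_distrib right_diff_distrib scale_mult_left scale_mult_right diff scale)
qed

text \<open>The difference is a multiple of a cumulant with entry 1. A lone entry is excluded, since
  \<open>\<kappa> [a] = \<psi> a\<close>.\<close>

lemma cumulant_center:
  assumes "u \<noteq> [] \<or> w \<noteq> []"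
  shows "\<kappa> (u @ center a # w) = \<kappa> (u @ a # w)"
proof -
  have "\<kappa> (u @ center a # w) = \<kappa> (u @ a # w) + - \<psi> a * \<kappa> (u @ 1 # w)"
    by (rule cumulant_linear) (simp add: linear_center[OF linear_\<psi>])
  moreover have "\<kappa> (u @ 1 # w) = 0"
    by (rule cumulant_unit) (use assms in auto)
  ultimately show ?thesis by simp
qed

lemma D_center: "D (u @ center a # w) = D (u @ a # w)"
proof -
  have "D (center a # w @ u) = D (a # w @ u) + - \<psi> a * D (1 # w @ u)"
    by (rule D_linear)
       (simp_all add: linear_center[OF linear_\<psi>] linear_center[OF linear_\<omega>, of 1, simplified])
  moreover have "D (1 # w @ u) = 0"
    by (rule D_unit) auto
  ultimately show ?thesis
    using D_rotate[of u "_ # w"] by simp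
qed

lemma cumulant_map_center:
  assumes "length as \<ge> 2"
  shows "\<kappa> (map center as) = \<kappa> as"
proof -
  have "\<kappa> (map center u @ w) = \<kappa> (u @ w)" if "length (u @ w) \<ge> 2" for u w
    using that
  proof (induction u arbitrary: w rule: rev_induct)
    case (snoc a u)
    then have "\<kappa> (map center u @ center a # w) = \<kappa> (map center u @ a # w)"
      by (intro cumulant_center) auto
    then show ?case using snoc.IH[of "a # w"] snoc.prems by simp
  qed simp
  from this[of as "[]"] assms show ?thesis by simp
qed

lemma D_map_center: "D (map center as) = D as"
proof -
  have "D (map center u @ w) = D (u @ w)" for u w
    by (induction u arbitrary: w rule: rev_induct) (simp_all add: D_center)
  from this[of as "[]"] show ?thesis by simp
qed

lemma word_in_map_center: "word_in I A js as \<Longrightarrow> word_in I A js (map center as)"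
  unfolding word_in_def list_all2_map2 by (erule list_all2_mono) (auto intro: center_in)

text \<open>The labels are existentially quantified, as an element may lie in several subalgebras;
  factors of the word can then be handled without naming their labels.\<close>

definition alternating :: "'a list \<Rightarrow> bool" where
  "alternating as \<longleftrightarrow> (\<exists>js. word_in I A js as \<and> distinct_adj js) \<and> (\<forall>a\<in>set as. \<psi> a = 0)"

lemma alternating_append:
  assumes "alternating (u @ v)"
  shows "alternating u" "alternating v"
proof -
  obtain js where js: "word_in I A js (u @ v)" "distinct_adj js" "\<forall>a\<in>set (u @ v). \<psi> a = 0"
    using assms unfolding alternating_def by blast
  obtain us vs where "js = us @ vs" "word_in I A us u" "word_in I A vs v"
    using word_in_append_right[OF js(1)] .
  then show "alternating u" "alternating v"
    using js(2,3) by (auto simp: alternating_def distinct_adj_append_iff)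
qed

lemma free_wrt_iff: "free_wrt I A \<psi> \<longleftrightarrow> (\<forall>as. alternating as \<and> as \<noteq> [] \<longrightarrow> M as = 0)"
  unfolding free_wrt_def alternating_def by (auto simp: Suc_le_eq)

text \<open>Every gap of the block of \<open>x\<close> is a factor of \<open>w\<close>. Nonempty
  ones contribute 0, so only the full block remains.\<close>

lemma moment_eq_cumulant:
  assumes "\<And>p q r. w = p @ q @ r \<Longrightarrow> q \<noteq> [] \<Longrightarrow> M q = 0"
  shows "M (x # w) = \<kappa> (x # w)"
proof -
  have "gap_sum M (\<lambda>v h. \<kappa> (x # v) * M h) [] w = \<kappa> (x # w) * M []"
  proof (rule gap_sum_full)
    show "\<kappa> (x # p) * M q = 0" if "w = p @ q" "q \<noteq> []" for p q
      using assms[of p q "[]"] that by simp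
  qed (use assms in \<open>auto simp: \<psi>_one\<close>)
  then show ?thesis unfolding M_Cons by (simp add: \<psi>_one)
qed

section \<open>Freeness and mixed free cumulants\<close>

definition mixed :: "'i list \<Rightarrow> bool" where
  "mixed js \<longleftrightarrow> (\<exists>j\<in>set js. \<exists>j'\<in>set js. j \<noteq> j')"

lemma mixed_iff: "j \<in> set js \<Longrightarrow> mixed js \<longleftrightarrow> (\<exists>j'\<in>set js. j' \<noteq> j)"
  unfolding mixed_def by metis

lemma mixed_length: "mixed js \<Longrightarrow> length js \<ge> 2"
  by (cases js; cases "tl js") (auto simp: mixed_def)

lemma distinct_adj_mixed: "distinct_adj js \<Longrightarrow> length js \<ge> 2 \<Longrightarrow> mixed js"
  by (cases js; cases "tl js") (auto simp: mixed_def)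

lemma mixed_cumulants_vanish_iff:
  "mixed_cumulants_vanish I A f \<longleftrightarrow> (\<forall>js as. word_in I A js as \<and> mixed js \<longrightarrow> f as = 0)"
  unfolding mixed_cumulants_vanish_def mixed_def ..

lemma free_imp_cumulants_vanish:
  assumes free: "free_wrt I A \<psi>"
  shows "mixed_cumulants_vanish I A \<kappa>"
proof -
  have "\<kappa> as = 0" if "word_in I A js as" "mixed js" for js as
    using that
  proof (induction "length as" arbitrary: js as rule: less_induct)
    case less
    note len = word_in_length[OF less.prems(1)] mixed_length[OF less.prems(2)]
    show ?case
    proof (cases "distinct_adj js")
      case True
      then have alt: "alternating (map center as)"
        using word_in_map_center[OF less.prems(1)] by (auto simp: alternating_def \<psi>_center)
      have *: "M q = 0" if "map center as = p @ q @ r" "q \<noteq> []" for p q r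
        using free alternating_append that alt unfolding free_wrt_iff by metis
      obtain x w where xw: "map center as = x # w" using len by (cases as) auto
      have "M (x # w) = \<kappa> (x # w)"
      proof (rule moment_eq_cumulant)
        show "M q = 0" if "w = p @ q @ r" "q \<noteq> []" for p q r
          using *[of "x # p" q r] that xw by simp
      qed
      moreover have "M (x # w) = 0" using *[of "[]" "x # w" "[]"] xw by simp
      ultimately show ?thesis using cumulant_map_center[of as] len xw by simp
    next
      case False
      then obtain us j vs where js: "js = us @ j # j # vs" using not_distinct_adj_split by blast
      obtain u a b w where as: "as = u @ a # b # w" and w: "word_in I A us u" "word_in I A vs w"
        "j \<in> I" "a \<in> A j" "b \<in> A j"
        using word_in_pair_split less.prems(1) js by metis
      have ab: "a * b \<in> A j" using subalgebra w by (auto simp: unital_subalgebra_def)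
      \<comment> \<open>It suffices to follow \<open>j\<close> and one other label
        \<open>j'\<close>: in each product of the product formula both factors have a letter
        labelled \<open>j\<close>, and \<open>j'\<close> occurs in one of them.\<close>
      obtain j' where j': "j' \<in> set us \<or> j' \<in> set vs" "j' \<noteq> j"
        using less.prems(2) js by (auto simp: mixed_iff[of j])
      have IH: "\<kappa> as' = 0" if "word_in I A js' as'" "length as' < length as" "j \<in> set js'" "j' \<in> set js'"
        for js' as'
        using less.hyps[OF that(2,1)] that(3,4) j'(2) mixed_def by blast
      note td = word_in_take_drop
      have "\<kappa> (u @ (a * b) # w) = 0"
        by (rule IH[of "us @ j # vs"])
           (use w ab j' as in \<open>auto intro!: word_in_append simp: word_in_Cons\<close>)
      moreover have "\<kappa> (b # take i w) * \<kappa> (u @ a # drop i w) = 0" if "i \<le> length w" for i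
      proof (cases "j' \<in> set (take i vs)")
        case True
        have "\<kappa> (b # take i w) = 0"
          by (rule IH[of "j # take i vs"]) (use True w td as in \<open>auto simp: word_in_Cons\<close>)
        then show ?thesis by simp
      next
        case False
        then have "j' \<in> set us \<or> j' \<in> set (drop i vs)"
          using j' by (metis Un_iff append_take_drop_id set_append)
        then have "\<kappa> (u @ a # drop i w) = 0"
          by (intro IH[of "us @ j # drop i vs"])
             (use w td as in \<open>auto intro!: word_in_append simp: word_in_Cons\<close>)
        then show ?thesis by simp
      qed
      moreover have "\<kappa> (take (Suc i) u @ b # w) * \<kappa> (drop (Suc i) u @ [a]) = 0" if "i < length u" for i
      proof (cases "j' \<in> set (drop (Suc i) us)")
        case True
        have "\<kappa> (drop (Suc i) u @ [a]) = 0"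
          by (rule IH[of "drop (Suc i) us @ [j]"])
             (use True w td as in \<open>auto intro!: word_in_append simp: word_in_Cons word_in_Nil\<close>)
        then show ?thesis by simp
      next
        case False
        then have "j' \<in> set (take (Suc i) us) \<or> j' \<in> set vs"
          using j' by (metis Un_iff append_take_drop_id set_append)
        then have "\<kappa> (take (Suc i) u @ b # w) = 0"
          by (intro IH[of "take (Suc i) us @ j # vs"])
             (use w td as in \<open>auto intro!: word_in_append simp: word_in_Cons\<close>)
        then show ?thesis by simp
      qed
      moreover have "\<kappa> (u @ (a * b) # w) = \<kappa> (u @ a # b # w)
          + (\<Sum>i\<le>length w. \<kappa> (b # take i w) * \<kappa> (u @ a # drop i w))
          + (\<Sum>i<length u. \<kappa> (take (Suc i) u @ b # w) * \<kappa> (drop (Suc i) u @ [a]))"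
        by (rule cumulant_merge) (simp add: mult.assoc)
      ultimately show ?thesis by (simp add: as)
    qed
  qed
  then show ?thesis unfolding mixed_cumulants_vanish_iff by blast
qed

text \<open>By induction shorter alternating words have moment 0, so the moment is the cumulant of
  the whole word, which is mixed unless the word is a single centered letter.\<close>

lemma cumulants_vanish_imp_free:
  assumes "mixed_cumulants_vanish I A \<kappa>"
  shows "free_wrt I A \<psi>"
proof -
  have "M as = 0" if "alternating as" "as \<noteq> []" for as
    using that
  proof (induction "length as" arbitrary: as rule: less_induct)
    case less
    obtain x w where as: "as = x # w" using less.prems(2) by (cases as) auto
    have eq: "M (x # w) = \<kappa> (x # w)"
    proof (rule moment_eq_cumulant)
      fix p q r assume w: "w = p @ q @ r" "q \<noteq> []"
      have "alternating q"
        using alternating_append[of "x # p" "q @ r"] alternating_append(1)[of q r] less.prems(1) as w by simp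
      then show "M q = 0" using less.hyps[of q] w as by simp
    qed
    obtain js where js: "word_in I A js as" "distinct_adj js" "\<forall>a\<in>set as. \<psi> a = 0"
      using less.prems(1) by (auto simp: alternating_def)
    show ?case
    proof (cases "w = []")
      case True
      then show ?thesis using js(3) as by simp
    next
      case False
      then have "length js \<ge> 2" using word_in_length[OF js(1)] as by (cases w) auto
      then have "\<kappa> as = 0"
        using assms js distinct_adj_mixed unfolding mixed_cumulants_vanish_iff by blast
      then show ?thesis using eq as by simp
    qed
  qed
  then show ?thesis unfolding free_wrt_iff by blast
qed

section \<open>Cyclic freeness and mixed cyclic free cumulants\<close>

lemma cyclic_moment_eq_cumulant:
  assumes free: "free_wrt I A \<psi>" and "as \<noteq> []"
    and js: "word_in I A js as" "distinct_adj js" "last js \<noteq> hd js" "\<forall>a\<in>set as. \<psi> a = 0"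
  shows "N as = D as"
proof -
  have zero: "M q = 0" if "alternating q" "q \<noteq> []" for q
    using free that unfolding free_wrt_iff by blast
  have alt: "alternating as" using js by (auto simp: alternating_def)
  \<comment> \<open>The arc through the end of the word reads \<open>q @ p\<close>. It stays
    alternating at the junction because the last label differs from the first.\<close>
  have wrap: "alternating (q @ p)" if as: "as = p @ y # r @ q" for p y r q
  proof -
    obtain ps ks where 1: "js = ps @ ks" "word_in I A ps p" "word_in I A ks (y # r @ q)"
      using word_in_append_right[of I A js p "y # r @ q"] js(1) as by metis
    obtain ms qs where 2: "ks = ms @ qs" "word_in I A ms (y # r)" "word_in I A qs q"
      using word_in_append_right[of I A ks "y # r" q] 1(3) by (metis append_Cons)
    have "distinct_adj ps" "distinct_adj qs"
      using js(2) unfolding 1(1) 2(1) by (auto dest: distinct_adj_appendD1 distinct_adj_appendD2)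
    moreover have "last qs \<noteq> hd ps" if "ps \<noteq> []" "qs \<noteq> []"
      using js(3) that by (simp add: 1(1) 2(1))
    ultimately have "distinct_adj (qs @ ps)" by (auto simp: distinct_adj_append_iff)
    moreover have "word_in I A (qs @ ps) (q @ p)" using 1 2 word_in_append by blast
    ultimately show ?thesis using js(4) as by (auto simp: alternating_def)
  qed
  \<comment> \<open>Among the blocks with first letter \<open>y\<close>, only the one containing all
    of \<open>w\<close> leaves no vanishing arc besides possibly \<open>p\<close>.\<close>
  have step: "gap_sum M (\<lambda>v h. D (y # v) * M (h @ p)) [] w = D (y # w) * M p"
    if as: "as = p @ y # w" for p y w
  proof (subst gap_sum_full)
    show "M q = 0" if "w = p' @ q @ r" "q \<noteq> []" for p' q r
    proof -
      have "as = (p @ y # p') @ q @ r" using as that by simp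
      then have "alternating q" using alt alternating_append by metis
      then show ?thesis using zero that by blast
    qed
    show "D (y # p') * M (q @ p) = 0" if "w = p' @ q" "q \<noteq> []" for p' q
      using zero[OF wrap[of p y p' q]] as that by simp
  qed (simp_all add: \<psi>_one)
  have "N as = (\<Sum>i<length as. gap_sum M (\<lambda>v h. D (as ! i # v) * M (h @ [] @ take i as)) [] (drop (Suc i) as))"
    unfolding N_eq avoiding_sum_eq_sum ..
  also have "\<dots> = (\<Sum>i<length as. D (as ! i # drop (Suc i) as) * M (take i as))"
    by (intro sum.cong refl) (use step in \<open>simp add: id_take_nth_drop\<close>)
  \<comment> \<open>For \<open>i > 0\<close> the remaining arc \<open>take i as\<close> is nonempty
    and alternating, so only the full block survives.\<close>
  also have "\<dots> = (\<Sum>i<length as. if i = 0 then D as else 0)"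
  proof (rule sum.cong[OF refl])
    fix i assume i: "i \<in> {..<length as}"
    show "D (as ! i # drop (Suc i) as) * M (take i as) = (if i = 0 then D as else 0)"
    proof (cases "i = 0")
      case True
      then show ?thesis using i Cons_nth_drop_Suc[of 0 as] by (simp add: \<psi>_one)
    next
      case False
      have "alternating (take i as)" using alternating_append(1)[of "take i as" "drop i as"] alt by simp
      moreover have "take i as \<noteq> []" using False i by auto
      ultimately show ?thesis using zero False by simp
    qed
  qed
  also have "\<dots> = D as"
    using \<open>as \<noteq> []\<close> by simp
  finally show ?thesis .
qed

text \<open>The cyclic product formula reduces the word to shorter ones. In every product a factor
  containing \<open>j'\<close> is mixed, and it vanishes whether it is a free or a cyclic cumulant.
  Equal neighbours elsewhere are rotated to the front.\<close>

lemma D_pair_vanish: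
  assumes \<kappa>: "mixed_cumulants_vanish I A \<kappa>"
    and IH: "\<And>js' as'. word_in I A js' as' \<Longrightarrow> mixed js' \<Longrightarrow> length as' < Suc (Suc (length w)) \<Longrightarrow> D as' = 0"
    and w: "word_in I A vs w" "j \<in> I" "a \<in> A j" "b \<in> A j" and mixed: "mixed (j # vs)"
  shows "D (a # b # w) = 0"
proof -
  have ab: "a * b \<in> A j" using subalgebra w by (auto simp: unital_subalgebra_def)
  obtain j' where j': "j' \<in> set vs" "j' \<noteq> j" using mixed by (auto simp: mixed_iff[of j])
  note td = word_in_take_drop
  have \<kappa>0: "\<kappa> as' = 0" if "word_in I A js' as'" "j \<in> set js'" "j' \<in> set js'" for js' as'
    using \<kappa> that j'(2) unfolding mixed_cumulants_vanish_iff mixed_def by blast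
  have D0: "D as' = 0" if "word_in I A js' as'" "length as' < Suc (Suc (length w))" "j \<in> set js'" "j' \<in> set js'"
    for js' as'
    using IH[OF that(1) _ that(2)] that(3,4) j'(2) unfolding mixed_def by blast
  have "D ((a * b) # w) = 0"
    by (rule D0[of "j # vs"]) (use w ab j' in \<open>auto simp: word_in_Cons\<close>)
  moreover have "\<kappa> (b # take i w) * D (a # drop i w) = 0" if "i \<le> length w" for i
  proof (cases "j' \<in> set (take i vs)")
    case True
    have "\<kappa> (b # take i w) = 0"
      by (rule \<kappa>0[of "j # take i vs"]) (use True w td in \<open>auto simp: word_in_Cons\<close>)
    then show ?thesis by simp
  next
    case False
    then have "j' \<in> set (drop i vs)"
      using j' by (metis Un_iff append_take_drop_id set_append)
    then have "D (a # drop i w) = 0"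
      by (intro D0[of "j # drop i vs"]) (use w td in \<open>auto simp: word_in_Cons\<close>)
    then show ?thesis by simp
  qed
  moreover have "D (b # take i w) * \<kappa> (drop i w @ [a]) = 0" if "i \<le> length w" for i
  proof (cases "j' \<in> set (take i vs)")
    case True
    have "D (b # take i w) = 0"
      by (rule D0[of "j # take i vs"]) (use True w td in \<open>auto simp: word_in_Cons\<close>)
    then show ?thesis by simp
  next
    case False
    then have "j' \<in> set (drop i vs)"
      using j' by (metis Un_iff append_take_drop_id set_append)
    then have "\<kappa> (drop i w @ [a]) = 0"
      by (intro \<kappa>0[of "drop i vs @ [j]"])
         (use w td in \<open>auto intro!: word_in_append simp: word_in_Cons word_in_Nil\<close>)
    then show ?thesis by simp
  qed
  moreover have "D ((a * b) # w) = D (a # b # w)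
      + (\<Sum>i\<le>length w. \<kappa> (b # take i w) * D (a # drop i w))
      + (\<Sum>i\<le>length w. D (b # take i w) * \<kappa> (drop i w @ [a]))"
    by (rule D_merge) (simp_all add: mult.assoc)
  ultimately show ?thesis by simp
qed

lemma cyclically_free_imp_cumulants_vanish:
  assumes cf: "cyclically_free I A \<psi> \<omega>"
  shows "mixed_cumulants_vanish I A D"
proof -
  have free: "free_wrt I A \<psi>" using cf by (simp add: cyclically_free_def)
  note \<kappa> = free_imp_cumulants_vanish[OF free]
  have "D as = 0" if "word_in I A js as" "mixed js" for js as
    using that
  proof (induction "length as" arbitrary: js as rule: less_induct)
    case less
    note len = word_in_length[OF less.prems(1)] mixed_length[OF less.prems(2)]
    \<comment> \<open>On the circle the last and the first letter are neighbours too, which gives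
      the case \<open>wrap\<close>.\<close>
    consider (pair) us j vs where "js = us @ j # j # vs" | (wrap) j ms where "js = j # ms @ [j]"
      | (alt) "distinct_adj js" "last js \<noteq> hd js"
    proof -
      have "\<exists>j ms. js = j # ms @ [j]" if "last js = hd js"
        using that len by (cases js; cases "tl js" rule: rev_cases) auto
      then show thesis using that not_distinct_adj_split by metis
    qed
    then show ?case
    proof cases
      case alt
      have wc: "word_in I A js (map center as)" using word_in_map_center[OF less.prems(1)] .
      have ne: "as \<noteq> []" using len by auto
      have c0: "\<forall>a\<in>set (map center as). \<psi> a = 0" by (simp add: \<psi>_center)
      have "N (map center as) = 0"
        using cf wc c0 alt len unfolding cyclically_free_def by (metis length_map)
      then show ?thesis
        using cyclic_moment_eq_cumulant[OF free _ wc alt c0] D_map_center ne by simp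
    next
      case pair
      obtain u a b w where as: "as = u @ a # b # w" and w: "word_in I A us u" "word_in I A vs w"
        "j \<in> I" "a \<in> A j" "b \<in> A j"
        using word_in_pair_split less.prems(1) pair by metis
      have "D (a # b # w @ u) = 0"
      proof (rule D_pair_vanish[OF \<kappa>])
        show "word_in I A (vs @ us) (w @ u)" using w word_in_append by blast
        show "mixed (j # vs @ us)" using less.prems(2) pair by (auto simp: mixed_def)
        show "D as' = 0" if "word_in I A js' as'" "mixed js'" "length as' < Suc (Suc (length (w @ u)))" for js' as'
          using less.hyps[OF _ that(1,2)] that(3) as by simp
      qed (use w in auto)
      then show ?thesis using D_rotate[of u "a # b # w"] as by simp
    next
      case wrap
      have "word_in I A ((j # ms) @ [j]) as" using less.prems(1) wrap by simp
      then obtain v v' where "as = v @ v'" "word_in I A (j # ms) v" "word_in I A [j] v'"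
        by (rule word_in_append_left)
      then obtain b where vb: "as = v @ [b]" "word_in I A (j # ms) v" "j \<in> I" "b \<in> A j"
        by (auto simp: word_in_def list_all2_Cons1)
      then obtain a w where v: "v = a # w" "word_in I A ms w" "a \<in> A j"
        by (auto simp: word_in_def list_all2_Cons1)
      \<comment> \<open>Rotating the last letter to the front places it next to the first letter,
        which lies in the same algebra.\<close>
      have "D (b # a # w) = 0"
      proof (rule D_pair_vanish[OF \<kappa>])
        show "mixed (j # ms)" using less.prems(2) wrap by (auto simp: mixed_def)
        show "D as' = 0" if "word_in I A js' as'" "mixed js'" "length as' < Suc (Suc (length w))" for js' as'
          using less.hyps[OF _ that(1,2)] that(3) vb v by simp
      qed (use v vb in auto)
      then show ?thesis using D_rotate1[of b "a # w"] vb v by simp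
    qed
  qed
  then show ?thesis unfolding mixed_cumulants_vanish_iff by blast
qed

lemma cumulants_vanish_imp_cyclically_free:
  assumes \<kappa>: "mixed_cumulants_vanish I A \<kappa>" and D: "mixed_cumulants_vanish I A D"
  shows "cyclically_free I A \<psi> \<omega>"
proof -
  note free = cumulants_vanish_imp_free[OF \<kappa>]
  have "N as = 0" if "word_in I A js as" "length as \<ge> 2" "\<forall>a\<in>set as. \<psi> a = 0" "distinct_adj js"
    "last js \<noteq> hd js" for js as
  proof -
    have "mixed js" using distinct_adj_mixed that word_in_length by metis
    then have "D as = 0" using D that(1) unfolding mixed_cumulants_vanish_iff by blast
    moreover have "as \<noteq> []" using that(2) by auto
    ultimately show ?thesis using cyclic_moment_eq_cumulant[OF free _ that(1,4,5,3)] by simp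
  qed
  then show ?thesis using free unfolding cyclically_free_def by blast
qed

end

theorem theorem2p6:
  fixes scale :: "complex \<Rightarrow> 'a::ring_1 \<Rightarrow> 'a"
    and \<psi> D\<psi> :: "'a \<Rightarrow> complex"
    and I :: "'i set" and A :: "'i \<Rightarrow> 'a set"
  assumes "complex_algebra scale"
    and "Vector_Spaces.linear scale (*) \<psi>" and "\<psi> 1 = 1"
    and "Vector_Spaces.linear scale (*) D\<psi>" and "tracial D\<psi>" and "D\<psi> 1 = 0"
    and "\<And>i. i \<in> I \<Longrightarrow> unital_subalgebra scale (A i)"
  shows "cyclically_free I A \<psi> D\<psi> \<longleftrightarrow>
    mixed_cumulants_vanish I A (free_cumulant \<psi>) \<and>
    mixed_cumulants_vanish I A (cyclic_free_cumulant \<psi> D\<psi>)"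
proof -
  interpret cyclic_freeness scale \<psi> D\<psi> I A
    by (intro cyclic_freeness.intro assms)
  show ?thesis
    using free_imp_cumulants_vanish cyclically_free_imp_cumulants_vanish
      cumulants_vanish_imp_cyclically_free
    by (auto simp: cyclically_free_def)
qed

end
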